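(* Let $G$ be a finitely generated metabelian group having exponential growth. Then there exists an injective regular map $\mathbb{Z}_2 \wr \mathbb{Z} \to G$.
   Context: $\mathbb{Z}_2=\mathbb{Z}/2\mathbb{Z}$, and $\mathbb{Z}_2 \wr \mathbb{Z} = \big(\bigoplus_{j\in\mathbb{Z}} \mathbb{Z}_2\big)\rtimes \mathbb{Z}$ is the lamplighter group, where $\mathbb{Z}$ acts by shifting coordinates. Regular maps: let $A$ and $B$ be simplicial graphs with bounded degree (identified with their vertex sets, with graph distances $d_A$, $d_B$). A map $\phi\colon A\to B$ is regular if (R1) there is $K>0$ such that $d_B(\phi(x),\phi(y))\le K\, d_A(x,y)$ for all $x,y\in A$, and (R2) there is $C\ge 1$ such that $|\phi^{-1}(x)|\le C$ for every $x\in B$. A map between finitely generated groups is called regular if it is regular as a map between Cayley graphs with respect to finite generating sets; this does not depend on the choice of the finite generating sets. In particular, an injective regular map is the same as an injective Lipschitz map. *)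

theory Defs
  imports
    "HOL-Algebra.Algebra"
    "Graph_Theory.Pair_Digraph"
    "Graph_Theory.Shortest_Path"
begin

section \<open>Regular maps between graphs\<close>

text \<open>
  A simplicial graph is an irreflexive symmetric relation on a possibly infinite vertex set,
  i.e. a \<^locale>\<open>pair_bidirected_digraph\<close>. Each undirected edge is represented by its two
  orientations, so the degree of a vertex is its out-degree. Since \<^const>\<open>card\<close> is 0 on
  infinite sets, finiteness of the neighbourhoods is required separately.
\<close>

definition bounded_degree_graph :: "'a pair_pre_digraph \<Rightarrow> bool" where
  "bounded_degree_graph A \<longleftrightarrow>
     pair_bidirected_digraph A \<and>
     (\<exists>D. \<forall>v \<in> pverts A. finite (out_arcs (with_proj A) v) \<and> out_degree (with_proj A) v \<le> D)"

text \<open>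
  The value is \<open>\<infinity>\<close> for vertices in distinct components.
\<close>

definition graph_dist :: "'a pair_pre_digraph \<Rightarrow> 'a \<Rightarrow> 'a \<Rightarrow> ereal" where
  "graph_dist A x y = wf_digraph.\<mu> (with_proj A) (\<lambda>_. 1) x y"

definition regular_graph_map ::
  "'a pair_pre_digraph \<Rightarrow> 'b pair_pre_digraph \<Rightarrow> ('a \<Rightarrow> 'b) \<Rightarrow> bool" where
  "regular_graph_map A B \<phi> \<longleftrightarrow>
     bounded_degree_graph A \<and> bounded_degree_graph B \<and>
     \<phi> \<in> pverts A \<rightarrow> pverts B \<and>
     (\<exists>K::real. K > 0 \<and> (\<forall>x \<in> pverts A. \<forall>y \<in> pverts A.
         graph_dist B (\<phi> x) (\<phi> y) \<le> ereal K * graph_dist A x y)) \<and>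
     (\<exists>C::real. C \<ge> 1 \<and> (\<forall>b \<in> pverts B.
         finite {a \<in> pverts A. \<phi> a = b} \<and> real (card {a \<in> pverts A. \<phi> a = b}) \<le> C))"


section \<open>Finitely generated groups\<close>

definition finite_generating_set :: "('a, 'b) monoid_scheme \<Rightarrow> 'a set \<Rightarrow> bool" where
  "finite_generating_set G S \<longleftrightarrow> finite S \<and> S \<subseteq> carrier G \<and> generate G S = carrier G"

definition finitely_generated :: "('a, 'b) monoid_scheme \<Rightarrow> bool" where
  "finitely_generated G \<longleftrightarrow> (\<exists>S. finite_generating_set G S)"

text \<open>
  The simplicial graph joining \<open>x\<close> to \<open>x \<otimes> s\<close> for \<open>s \<in> S\<close>; loops are discarded, and \<open>S\<close>
  is not assumed to be closed under inverses.
\<close>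

definition Cayley_graph :: "('a, 'b) monoid_scheme \<Rightarrow> 'a set \<Rightarrow> 'a pair_pre_digraph" where
  "Cayley_graph G S =
     \<lparr> pverts = carrier G,
       parcs = {(x, y). x \<in> carrier G \<and> y \<in> carrier G \<and> x \<noteq> y \<and>
                        (\<exists>s \<in> S. y = x \<otimes>\<^bsub>G\<^esub> s \<or> x = y \<otimes>\<^bsub>G\<^esub> s)} \<rparr>"

text \<open>
  Regularity does not depend on the generating sets. The definition asks for it with respect
  to all of them; the finite generation requirement excludes vacuous truth.
\<close>

definition regular_group_map ::
  "('a, 'c) monoid_scheme \<Rightarrow> ('b, 'd) monoid_scheme \<Rightarrow> ('a \<Rightarrow> 'b) \<Rightarrow> bool" where
  "regular_group_map H G \<phi> \<longleftrightarrow>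
     finitely_generated H \<and> finitely_generated G \<and>
     (\<forall>S T. finite_generating_set H S \<longrightarrow> finite_generating_set G T \<longrightarrow>
        regular_graph_map (Cayley_graph H S) (Cayley_graph G T) \<phi>)"

definition Cayley_ball :: "('a, 'b) monoid_scheme \<Rightarrow> 'a set \<Rightarrow> nat \<Rightarrow> 'a set" where
  "Cayley_ball G S n =
     {x \<in> carrier G. graph_dist (Cayley_graph G S) \<one>\<^bsub>G\<^esub> x \<le> ereal (real n)}"

text \<open>
  Exponential growth is likewise independent of the finite generating set.
  By submultiplicativity of the ball sizes \<open>\<beta> n\<close>, the limit of \<open>root n (\<beta> n)\<close> exists and is
  their infimum over \<open>n \<ge> 1\<close>, so the condition below says that this growth rate exceeds 1.
\<close>

definition exponential_growth :: "('a, 'b) monoid_scheme \<Rightarrow> bool" where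
  "exponential_growth G \<longleftrightarrow>
     (\<exists>S. finite_generating_set G S \<and>
          (\<exists>a::real. a > 1 \<and> (\<forall>n. a ^ n \<le> real (card (Cayley_ball G S n)))))"

definition metabelian :: "('a, 'b) monoid_scheme \<Rightarrow> bool" where
  "metabelian G \<longleftrightarrow> comm_group (G \<lparr> carrier := derived G (carrier G) \<rparr>)"


section \<open>The lamplighter group\<close>

definition semidirect_product ::
  "('a, 'c) monoid_scheme \<Rightarrow> ('b, 'd) monoid_scheme \<Rightarrow> ('b \<Rightarrow> 'a \<Rightarrow> 'a) \<Rightarrow> ('a \<times> 'b) monoid" where
  "semidirect_product N H \<alpha> =
     \<lparr> carrier = carrier N \<times> carrier H,
       monoid.mult = (\<lambda>(x, h) (y, k). (x \<otimes>\<^bsub>N\<^esub> \<alpha> h y, h \<otimes>\<^bsub>H\<^esub> k)),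
       one = (\<one>\<^bsub>N\<^esub>, \<one>\<^bsub>H\<^esub>) \<rparr>"

definition lamplighter_group :: "((int \<Rightarrow> int) \<times> int) monoid" where
  "lamplighter_group =
     semidirect_product (sum_group UNIV (\<lambda>_::int. integer_mod_group 2)) integer_group
       (\<lambda>m f j. f (j - m))"

lemma carrier_lamplighter_group:
  "carrier lamplighter_group = {f. (\<forall>i. f i \<in> {0..<2}) \<and> finite {i. f i \<noteq> 0}} \<times> UNIV"
  by (auto simp: lamplighter_group_def semidirect_product_def carrier_sum_group
      carrier_integer_mod_group PiE_def Pi_def)

lemma mult_lamplighter_group:
  "(f, m) \<otimes>\<^bsub>lamplighter_group\<^esub> (g, n) = (\<lambda>j. (f j + g (j - m)) mod 2, m + n)"
  by (simp add: lamplighter_group_def semidirect_product_def fun_eq_iff)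

lemma one_lamplighter_group: "\<one>\<^bsub>lamplighter_group\<^esub> = (\<lambda>_. 0, 0)"
  by (simp add: lamplighter_group_def semidirect_product_def fun_eq_iff)

lemma finite_support_shift:
  fixes f :: "int \<Rightarrow> int"
  assumes "finite {i. f i \<noteq> 0}"
  shows "finite {i. f (i - m) \<noteq> 0}"
proof -
  have "{i. f (i - m) \<noteq> 0} = (\<lambda>i. i + m) ` {i. f i \<noteq> 0}"
    by (auto intro!: image_eqI[where x = "_ - m"])
  then show ?thesis using assms by simp
qed

lemma group_lamplighter_group: "group lamplighter_group"
proof (rule groupI)
  fix x y assume "x \<in> carrier lamplighter_group" "y \<in> carrier lamplighter_group"
  then obtain f m g n where xy: "x = (f, m)" "y = (g, n)"
    and f: "finite {i. f i \<noteq> 0}" and g: "finite {i. g i \<noteq> 0}"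
    by (auto simp: carrier_lamplighter_group)
  have "finite {i. (f i + g (i - m)) mod 2 \<noteq> 0}"
    by (rule finite_subset[OF _ finite_UnI[OF f finite_support_shift[OF g, of m]]]) auto
  then show "x \<otimes>\<^bsub>lamplighter_group\<^esub> y \<in> carrier lamplighter_group"
    by (auto simp: xy mult_lamplighter_group carrier_lamplighter_group)
next
  show "\<one>\<^bsub>lamplighter_group\<^esub> \<in> carrier lamplighter_group"
    by (auto simp: one_lamplighter_group carrier_lamplighter_group)
next
  fix x y z
  show "x \<otimes>\<^bsub>lamplighter_group\<^esub> y \<otimes>\<^bsub>lamplighter_group\<^esub> z =
        x \<otimes>\<^bsub>lamplighter_group\<^esub> (y \<otimes>\<^bsub>lamplighter_group\<^esub> z)"
    by (cases x; cases y; cases z)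
      (simp add: mult_lamplighter_group mod_add_left_eq mod_add_right_eq algebra_simps)
next
  fix x assume "x \<in> carrier lamplighter_group"
  then obtain f m where x: "x = (f, m)" and r: "\<forall>i. f i \<in> {0..<2}"
    and f: "finite {i. f i \<noteq> 0}"
    by (auto simp: carrier_lamplighter_group)
  have "f i mod 2 = f i" for i
    using r by (simp add: mod_pos_pos_trivial)
  then show "\<one>\<^bsub>lamplighter_group\<^esub> \<otimes>\<^bsub>lamplighter_group\<^esub> x = x"
    by (simp add: x one_lamplighter_group mult_lamplighter_group)
  let ?y = "(\<lambda>j. f (j - (- m)), - m)"
  have "?y \<in> carrier lamplighter_group"
    using r finite_support_shift[OF f, of "- m"] by (auto simp: carrier_lamplighter_group)
  moreover have "?y \<otimes>\<^bsub>lamplighter_group\<^esub> x = \<one>\<^bsub>lamplighter_group\<^esub>"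
    by (simp add: x one_lamplighter_group mult_lamplighter_group)
  ultimately show "\<exists>y\<in>carrier lamplighter_group.
      y \<otimes>\<^bsub>lamplighter_group\<^esub> x = \<one>\<^bsub>lamplighter_group\<^esub>" by blast
qed

lemma bounded_degree_Cayley_graph:
  assumes "group G" "finite S" "S \<subseteq> carrier G"
  shows "bounded_degree_graph (Cayley_graph G S)"
proof -
  interpret group G by fact
  have "pair_bidirected_digraph (Cayley_graph G S)"
    by unfold_locales (auto simp: Cayley_graph_def Digraph.symmetric_def sym_def)
  moreover have "finite (out_arcs (with_proj (Cayley_graph G S)) v) \<and>
      out_degree (with_proj (Cayley_graph G S)) v \<le> card S + card S" if "v \<in> carrier G" for v
  proof -
    let ?N = "(\<lambda>s. (v, v \<otimes>\<^bsub>G\<^esub> s)) ` S \<union> (\<lambda>s. (v, v \<otimes>\<^bsub>G\<^esub> inv\<^bsub>G\<^esub> s)) ` S"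
    have sub: "out_arcs (with_proj (Cayley_graph G S)) v \<subseteq> ?N"
    proof
      fix e assume e: "e \<in> out_arcs (with_proj (Cayley_graph G S)) v"
      then obtain y s where *: "e = (v, y)" "y \<in> carrier G" "s \<in> S"
        "y = v \<otimes>\<^bsub>G\<^esub> s \<or> v = y \<otimes>\<^bsub>G\<^esub> s"
        by (auto simp: Cayley_graph_def out_arcs_def)
      from \<open>s \<in> S\<close> assms(3) have s: "s \<in> carrier G" by blast
      from *(4) have "y = v \<otimes>\<^bsub>G\<^esub> s \<or> y = v \<otimes>\<^bsub>G\<^esub> inv\<^bsub>G\<^esub> s"
        using s *(2) by (auto simp: m_assoc)
      then show "e \<in> ?N"
        using *(1,3) by blast
    qed
    have fin: "finite ?N" using assms(2) by simp
    have "card ?N \<le> card S + card S"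
      by (rule order_trans[OF card_Un_le])
        (intro add_mono card_image_le assms(2))
    then show ?thesis
      using sub fin card_mono[OF fin sub] by (auto simp: out_degree_def intro: finite_subset)
  qed
  ultimately show ?thesis
    unfolding bounded_degree_graph_def by (auto simp: Cayley_graph_def)
qed

end

theory Submission
  imports Defs
begin

text \<open>
  Let \<open>M\<close> be the derived subgroup of \<open>G\<close>. For \<open>t\<close> in \<open>G\<close> and \<open>a\<close> in \<open>M\<close>, send the lamp configuration \<open>f\<close>
  with end position \<open>m\<close> to the product of the conjugates \<open>t^i a t^-i\<close> over the lit lamps \<open>i\<close>, times \<open>t^m\<close>.
  A step of the lamplighter multiplies this on the right by \<open>t\<close>, and switching the lamp at the current
  position multiplies it on the right by \<open>a\<close> or its inverse. The map is therefore always Lipschitz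
  (\<open>lamplighter_map_regular\<close>), and it suffices to find \<open>t\<close> and \<open>a\<close> for which it is injective.

  Suppose that there are none. Comparing two configurations with the same image yields, for all \<open>t\<close> and
  \<open>a\<close>, a relation which expresses \<open>t^d a t^-d\<close> by the earlier conjugates with exponents in \<open>{-1, 0, 1}\<close>
  (\<open>monic_relation_if_not_inj\<close>). This forces subexponential growth, in three steps.

  \<^item> By division with remainder, the orbit of \<open>a\<close> under \<open>t\<close> stays in the span of its first \<open>d\<close> elements.
    Iterating over a finite set of letters, one obtains a finite subset \<open>F\<close> of \<open>M\<close> which contains the
    commutators of the letters and whose span is invariant under them (\<open>invariant_span_extension\<close>).

  \<^item> Each step of the division at most doubles the exponents of the remainder. Applied to \<open>t^k\<close> in place
    of \<open>t\<close>, this bounds the exponents of \<open>t^n a t^-n\<close> over \<open>F\<close> by a constant times \<open>2^(n/k)\<close>, hence, for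
    every base \<open>b > 1\<close>, by a constant times \<open>b^n\<close> (\<open>orbit_growth\<close>). The same then holds for conjugation by
    words of length \<open>n\<close> (\<open>word_action_growth\<close>).

  \<^item> Permuting the letters of a word of length \<open>n\<close> changes its value by at most \<open>n\<^sup>2\<close> conjugated commutators
    (\<open>permute_letters\<close>). Words of length \<open>n\<close> in \<open>p\<close> letters thus have at most
    \<open>(n + 1)^p (2 n\<^sup>2 C b^n + 1)^q\<close> values, where \<open>q\<close> is the number of elements of \<open>F\<close>. As \<open>p\<close> and \<open>q\<close> do not
    depend on \<open>b\<close>, a choice of \<open>b\<close> close to 1 contradicts exponential growth
    (\<open>exponential_growth_excludes_monic_relations\<close>).
\<close>

section \<open>Products with bounded exponents in an abelian group\<close>

text \<open>
  The bound is real so that it can be a multiple of \<open>b ^ n\<close> with a base \<open>b\<close> close to 1. The generators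
  form an indexed family, since the translates \<open>t^i a t^-i\<close> to which this is applied may coincide.
\<close>

definition coef_box :: "('a, 'b) monoid_scheme \<Rightarrow> ('i \<Rightarrow> 'a) \<Rightarrow> 'i set \<Rightarrow> real \<Rightarrow> 'a set" where
  "coef_box K x I c =
     {finprod K (\<lambda>i. x i [^]\<^bsub>K\<^esub> z i) I | z :: 'i \<Rightarrow> int. \<forall>i\<in>I. real_of_int \<bar>z i\<bar> \<le> c}"

lemma coef_box_mono: "c \<le> d \<Longrightarrow> coef_box K x I c \<subseteq> coef_box K x I d"
  unfolding coef_box_def by fastforce

context comm_group begin

lemma coef_box_closed:
  assumes "x \<in> I \<rightarrow> carrier G"
  shows "coef_box G x I c \<subseteq> carrier G"
  using assms unfolding coef_box_def by (auto intro!: finprod_closed)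

lemma one_in_coef_box: "0 \<le> c \<Longrightarrow> \<one> \<in> coef_box G x I c"
  unfolding coef_box_def by (force intro!: exI[of _ "\<lambda>_. 0"])

lemma coef_box_mult:
  assumes x: "x \<in> I \<rightarrow> carrier G"
    and "u \<in> coef_box G x I c" "v \<in> coef_box G x I d"
  shows "u \<otimes> v \<in> coef_box G x I (c + d)"
proof -
  obtain y z where y: "u = finprod G (\<lambda>i. x i [^] (y i :: int)) I" "\<forall>i\<in>I. real_of_int \<bar>y i\<bar> \<le> c"
    and z: "v = finprod G (\<lambda>i. x i [^] (z i :: int)) I" "\<forall>i\<in>I. real_of_int \<bar>z i\<bar> \<le> d"
    using assms(2,3) unfolding coef_box_def by blast
  have "u \<otimes> v = finprod G (\<lambda>i. x i [^] (y i) \<otimes> x i [^] (z i)) I"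
    unfolding y z using x by (subst finprod_multf) auto
  also have "\<dots> = finprod G (\<lambda>i. x i [^] (y i + z i)) I"
    using x by (intro finprod_cong') (auto simp: int_pow_mult Pi_iff)
  finally show ?thesis
    using y(2) z(2) unfolding coef_box_def by (force intro!: exI[of _ "\<lambda>i. y i + z i"])
qed

lemma finprod_int_pow:
  assumes "f \<in> I \<rightarrow> carrier G"
  shows "finprod G f I [^] (n::int) = finprod G (\<lambda>i. f i [^] n) I"
  using assms
proof (induct I rule: infinite_finite_induct)
  case (insert a I)
  then have "finprod G f I \<in> carrier G" by (intro finprod_closed) auto
  with insert show ?case by (subst (1 2) finprod_insert) (auto simp: int_pow_distrib)
qed auto

lemma coef_box_pow:
  assumes x: "x \<in> I \<rightarrow> carrier G" and "u \<in> coef_box G x I c"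
    and "real_of_int \<bar>n\<bar> \<le> e" "0 \<le> c"
  shows "u [^] n \<in> coef_box G x I (e * c)"
proof -
  obtain y where y: "u = finprod G (\<lambda>i. x i [^] (y i :: int)) I" "\<forall>i\<in>I. real_of_int \<bar>y i\<bar> \<le> c"
    using assms(2) unfolding coef_box_def by blast
  have "u [^] n = finprod G (\<lambda>i. (x i [^] y i) [^] n) I"
    unfolding y(1) using x by (intro finprod_int_pow) auto
  also have "\<dots> = finprod G (\<lambda>i. x i [^] (y i * n)) I"
    using x by (intro finprod_cong') (auto simp: int_pow_pow Pi_iff)
  finally have "u [^] n = finprod G (\<lambda>i. x i [^] (y i * n)) I" .
  moreover have "real_of_int \<bar>y i * n\<bar> \<le> e * c" if "i \<in> I" for i
    using mult_mono[of "\<bar>n\<bar>" e "\<bar>y i\<bar>" c] y(2) that assms(3,4) by (auto simp: abs_mult mult.commute)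
  ultimately show ?thesis
    unfolding coef_box_def by (auto intro!: exI[of _ "\<lambda>i. y i * n"])
qed

lemma coef_box_generator:
  assumes x: "x \<in> I \<rightarrow> carrier G" and "finite I" "i \<in> I"
  shows "x i \<in> coef_box G x I 1"
proof -
  have "finprod G (\<lambda>j. x j [^] (if j = i then 1 else 0::int)) I
      = finprod G (\<lambda>j. if i = j then x j else \<one>) I"
    using x assms(3) by (intro finprod_cong') (auto simp: Pi_iff)
  also have "\<dots> = x i" using finprod_singleton[OF assms(3,2) x] by simp
  finally have "x i = finprod G (\<lambda>j. x j [^] (if j = i then 1 else 0::int)) I" by simp
  then show ?thesis unfolding coef_box_def by force
qed

lemma coef_box_finprod:
  assumes x: "x \<in> I \<rightarrow> carrier G" and "finite J"
    and "\<And>j. j \<in> J \<Longrightarrow> u j \<in> coef_box G x I c"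
  shows "finprod G u J \<in> coef_box G x I (real (card J) * c)"
  using assms(2,3)
proof (induct J)
  case empty
  then show ?case by (simp add: one_in_coef_box)
next
  case (insert j J)
  then have "finprod G u (insert j J) = u j \<otimes> finprod G u J"
    using coef_box_closed[OF x] by (subst finprod_insert) auto
  moreover have "u j \<otimes> finprod G u J \<in> coef_box G x I (c + real (card J) * c)"
    using insert by (intro coef_box_mult x) auto
  ultimately show ?case using insert(1,2) by (simp add: algebra_simps)
qed

lemma hom_finprod:
  assumes "h \<in> hom G G" "f \<in> I \<rightarrow> carrier G"
  shows "h (finprod G f I) = finprod G (\<lambda>i. h (f i)) I"
  using assms(2)
proof (induct I rule: infinite_finite_induct)
  case (insert a I)
  moreover have "finprod G f I \<in> carrier G" using insert by (intro finprod_closed) auto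
  ultimately show ?case
    using assms(1) by (subst (1 2) finprod_insert) (auto simp: hom_def Pi_def)
qed (use assms(1) hom_one[OF assms(1) is_group is_group] in auto)

lemma coef_box_hom_finprod:
  assumes "h \<in> hom G G" and x: "x \<in> I \<rightarrow> carrier G"
  shows "h (finprod G (\<lambda>i. x i [^] (z i :: int)) I) = finprod G (\<lambda>i. h (x i) [^] z i) I"
proof -
  interpret group_hom G G h using assms(1) by unfold_locales
  have "h (finprod G (\<lambda>i. x i [^] (z i :: int)) I) = finprod G (\<lambda>i. h (x i [^] z i)) I"
    using x by (intro hom_finprod assms) auto
  also have "\<dots> = finprod G (\<lambda>i. h (x i) [^] z i) I"
    using x by (intro finprod_cong') (auto intro!: hom_int_pow simp: Pi_iff)
  finally show ?thesis .
qed

lemma coef_box_hom: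
  assumes h: "h \<in> hom G G" and x: "x \<in> I \<rightarrow> carrier G" and y: "y \<in> J \<rightarrow> carrier G"
    and "finite I" "0 \<le> d"
    and hx: "\<And>i. i \<in> I \<Longrightarrow> h (x i) \<in> coef_box G y J d"
    and v: "v \<in> coef_box G x I c"
  shows "h v \<in> coef_box G y J (real (card I) * (c * d))"
proof -
  obtain z where z: "v = finprod G (\<lambda>i. x i [^] (z i :: int)) I" "\<forall>i\<in>I. real_of_int \<bar>z i\<bar> \<le> c"
    using v unfolding coef_box_def by blast
  show ?thesis
    unfolding z(1) coef_box_hom_finprod[OF h x]
    using z(2) by (intro coef_box_finprod y assms(4) coef_box_pow hx) (auto simp: assms)
qed

text \<open>
  Multiplication by the variable in a quotient of a polynomial ring by a monic polynomial: all
  exponents move up by one place, and the top term is rewritten by the relation. For a relation with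
  coefficients in \<open>{-1, 0, 1}\<close>, that is \<open>e = 1\<close>, the bound on the exponents only doubles.
\<close>

lemma coef_box_shift:
  fixes x :: "nat \<Rightarrow> 'a" and z :: "nat \<Rightarrow> int"
  assumes x: "\<And>i. x i \<in> carrier G"
    and top: "x d \<in> coef_box G x {..<d} e" "0 \<le> e"
    and z: "\<forall>i<d. real_of_int \<bar>z i\<bar> \<le> c" and "0 \<le> c"
  shows "finprod G (\<lambda>i. x (Suc i) [^] z i) {..<d} \<in> coef_box G x {..<d} (c + c * e)"
proof (cases d)
  case 0
  then show ?thesis using assms by (simp add: one_in_coef_box)
next
  case (Suc k)
  define z' where "z' i = (case i of 0 \<Rightarrow> 0 | Suc j \<Rightarrow> z j)" for i
  have "finprod G (\<lambda>i. x (Suc i) [^] z i) {..<k} = finprod G (\<lambda>i. x i [^] z' i) (Suc ` {..<k})"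
    by (subst finprod_reindex) (auto simp: z'_def x)
  also have "\<dots> = finprod G (\<lambda>i. x i [^] z' i) {..<d}"
    unfolding Suc lessThan_Suc_eq_insert_0 using x by (subst finprod_insert) (auto simp: z'_def)
  also have "\<dots> \<in> coef_box G x {..<d} c"
    using z \<open>0 \<le> c\<close> unfolding coef_box_def z'_def by (force simp: Suc split: nat.split)
  finally have "finprod G (\<lambda>i. x (Suc i) [^] z i) {..<k} \<in> coef_box G x {..<d} c" .
  moreover have "x d [^] z k \<in> coef_box G x {..<d} (c * e)"
    using z Suc by (intro coef_box_pow top) (auto simp: x)
  moreover have "finprod G (\<lambda>i. x (Suc i) [^] z i) {..<d}
      = finprod G (\<lambda>i. x (Suc i) [^] z i) {..<k} \<otimes> x d [^] z k"
    unfolding Suc lessThan_Suc using x by (subst finprod_insert) (auto intro!: m_comm finprod_closed)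
  ultimately show ?thesis by (auto intro!: coef_box_mult x)
qed

lemma finite_card_coef_box:
  assumes x: "x \<in> I \<rightarrow> carrier G" and "finite I" "0 \<le> c"
  shows "finite (coef_box G x I c)" "real (card (coef_box G x I c)) \<le> (2 * c + 1) ^ card I"
proof -
  let ?Z = "I \<rightarrow>\<^sub>E {-\<lfloor>c\<rfloor>..\<lfloor>c\<rfloor>}"
  have sub: "coef_box G x I c \<subseteq> (\<lambda>z. finprod G (\<lambda>i. x i [^] z i) I) ` ?Z"
  proof
    fix u assume "u \<in> coef_box G x I c"
    then obtain z where z: "u = finprod G (\<lambda>i. x i [^] (z i :: int)) I" "\<forall>i\<in>I. real_of_int \<bar>z i\<bar> \<le> c"
      unfolding coef_box_def by blast
    have "z i \<in> {-\<lfloor>c\<rfloor>..\<lfloor>c\<rfloor>}" if "i \<in> I" for i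
    proof -
      have "\<bar>z i\<bar> \<le> \<lfloor>c\<rfloor>" using z(2) that by (simp add: le_floor_iff)
      then show ?thesis by auto
    qed
    then have "restrict z I \<in> ?Z" by auto
    moreover have "u = finprod G (\<lambda>i. x i [^] restrict z I i) I"
      unfolding z(1) using x by (intro finprod_cong') (auto simp: Pi_iff)
    ultimately show "u \<in> (\<lambda>z. finprod G (\<lambda>i. x i [^] z i) I) ` ?Z" by blast
  qed
  have fin: "finite ?Z" using assms(2) by (auto intro: finite_PiE)
  then show "finite (coef_box G x I c)" using sub finite_surj by blast
  have "card (coef_box G x I c) \<le> card ?Z"
    using surj_card_le[OF fin sub] .
  also have "card ?Z = nat (2 * \<lfloor>c\<rfloor> + 1) ^ card I"
    using assms(2) by (simp add: card_PiE algebra_simps)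
  finally have "real (card (coef_box G x I c)) \<le> real (nat (2 * \<lfloor>c\<rfloor> + 1)) ^ card I"
    by (metis of_nat_le_iff of_nat_power)
  also have "real (nat (2 * \<lfloor>c\<rfloor> + 1)) \<le> 2 * c + 1" using assms(3) by linarith
  then have "real (nat (2 * \<lfloor>c\<rfloor> + 1)) ^ card I \<le> (2 * c + 1) ^ card I"
    by (intro power_mono) auto
  finally show "real (card (coef_box G x I c)) \<le> (2 * c + 1) ^ card I" .
qed

end

section \<open>The conjugation action on an abelian normal subgroup\<close>

text \<open>
  An abelian normal subgroup with abelian quotient, the quotient being expressed through
  commutators.
\<close>

locale metabelian_extension = normal M G + abelian: comm_group "G\<lparr>carrier := M\<rparr>"
  for M and G (structure) +
  assumes commutator_in: "x \<in> carrier G \<Longrightarrow> y \<in> carrier G \<Longrightarrow> x \<otimes> y \<otimes> inv x \<otimes> inv y \<in> M"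
begin

abbreviation "K \<equiv> G\<lparr>carrier := M\<rparr>"

definition act :: "'a \<Rightarrow> 'a \<Rightarrow> 'a" where
  "act g x = g \<otimes> x \<otimes> inv g"

lemma in_carrier: "x \<in> M \<Longrightarrow> x \<in> carrier G"
  using subset by blast

lemma act_closed [simp]: "g \<in> carrier G \<Longrightarrow> x \<in> M \<Longrightarrow> act g x \<in> M"
  unfolding act_def by (rule inv_op_closed2)

lemma act_one [simp]: "x \<in> M \<Longrightarrow> act \<one> x = x"
  unfolding act_def by (simp add: in_carrier)

lemma act_mult:
  assumes "g \<in> carrier G" "h \<in> carrier G" "x \<in> M"
  shows "act (g \<otimes> h) x = act g (act h x)"
  unfolding act_def using assms in_carrier by (simp add: m_assoc inv_mult_group)

lemma act_hom: assumes "g \<in> carrier G" shows "act g \<in> hom K K"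
proof -
  have "act g (x \<otimes> y) = act g x \<otimes> act g y" if "x \<in> M" "y \<in> M" for x y
  proof -
    have xy: "x \<in> carrier G" "y \<in> carrier G" using that in_carrier by auto
    have "inv g \<otimes> (g \<otimes> (y \<otimes> inv g)) = y \<otimes> inv g"
      using assms xy by (simp add: m_assoc[symmetric])
    then show ?thesis unfolding act_def using assms xy by (simp add: m_assoc)
  qed
  then show ?thesis using assms by (auto simp: hom_def)
qed

lemma act_trivial:
  assumes "m \<in> M" "x \<in> M" shows "act m x = x"
proof -
  have "m \<otimes> x = x \<otimes> m" using abelian.m_comm[of m x] assms by simp
  then show ?thesis unfolding act_def using assms in_carrier by (simp add: m_assoc)
qed

lemma commutator_swap:
  assumes "x \<in> carrier G" "y \<in> carrier G"
  shows "x \<otimes> y = (x \<otimes> y \<otimes> inv x \<otimes> inv y) \<otimes> (y \<otimes> x)"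
proof -
  have "inv y \<otimes> (y \<otimes> x) = x" "inv x \<otimes> x = \<one>"
    using assms by (simp_all add: m_assoc[symmetric])
  then show ?thesis using assms by (simp add: m_assoc)
qed

text \<open>
  The elements \<open>g h\<close> and \<open>h g\<close> differ by a commutator, which lies in \<open>M\<close> and therefore acts trivially:
  the action factors through the abelian quotient.
\<close>

lemma act_commute:
  assumes "g \<in> carrier G" "h \<in> carrier G" "x \<in> M"
  shows "act g (act h x) = act h (act g x)"
proof -
  have "act g (act h x) = act ((g \<otimes> h \<otimes> inv g \<otimes> inv h) \<otimes> (h \<otimes> g)) x"
    using assms by (simp add: act_mult flip: commutator_swap)
  also have "\<dots> = act (g \<otimes> h \<otimes> inv g \<otimes> inv h) (act (h \<otimes> g) x)"
    by (rule act_mult) (use assms in auto)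
  also have "\<dots> = act (h \<otimes> g) x"
    by (rule act_trivial) (use assms commutator_in in auto)
  finally show ?thesis using assms by (simp add: act_mult)
qed

lemma act_pow_Suc:
  "t \<in> carrier G \<Longrightarrow> a \<in> M \<Longrightarrow> act (t [^] Suc n) a = act t (act (t [^] n) a)"
  by (simp only: nat_pow_Suc2) (simp add: act_mult)

lemma act_pow_add:
  "t \<in> carrier G \<Longrightarrow> a \<in> M \<Longrightarrow> act (t [^] (m + n :: nat)) a = act (t [^] m) (act (t [^] n) a)"
  by (simp add: act_mult flip: nat_pow_mult)

text \<open>
  In module notation, a monic polynomial in \<open>t\<close> whose other coefficients are in \<open>{-1, 0, 1}\<close> kills
  \<open>a\<close>. For \<open>d = 0\<close> this says that \<open>a\<close> is trivial.
\<close>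

definition monic_relation :: "'a \<Rightarrow> 'a \<Rightarrow> bool" where
  "monic_relation t a \<longleftrightarrow>
     (\<exists>d::nat. act (t [^] d) a \<in> coef_box K (\<lambda>i. act (t [^] i) a) {..<d} 1)"

text \<open>
  Division with remainder by the monic relation, one power of \<open>t\<close> at a time. The bound \<open>2 ^ n\<close> depends
  neither on \<open>t\<close> nor on the degree \<open>d\<close>, which is what later makes it useful to replace \<open>t\<close> by a large
  power of itself.
\<close>

lemma orbit_coef_box:
  fixes d :: nat
  assumes t: "t \<in> carrier G" and a: "a \<in> M"
    and rel: "act (t [^] d) a \<in> coef_box K (\<lambda>i. act (t [^] i) a) {..<d} 1"
  shows "act (t [^] (n::nat)) a \<in> coef_box K (\<lambda>i. act (t [^] i) a) {..<d} (2 ^ n)"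
proof -
  define x where "x = (\<lambda>i::nat. act (t [^] i) a)"
  have x: "x i \<in> carrier K" for i using t a by (simp add: x_def)
  have "x n \<in> coef_box K x {..<d} (2 ^ n)"
  proof (induct n)
    case 0
    show ?case
    proof (cases "d = 0")
      case True then show ?thesis using rel by (simp add: x_def)
    next
      case False
      then show ?thesis using abelian.coef_box_generator[of x "{..<d}" 0] x by (auto simp: Pi_iff)
    qed
  next
    case (Suc n)
    then obtain z where z: "x n = finprod K (\<lambda>i. x i [^]\<^bsub>K\<^esub> (z i :: int)) {..<d}"
      "\<forall>i<d. real_of_int \<bar>z i\<bar> \<le> 2 ^ n"
      unfolding coef_box_def by auto
    have "x (Suc n) = act t (finprod K (\<lambda>i. x i [^]\<^bsub>K\<^esub> (z i :: int)) {..<d})"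
      using t a act_pow_Suc unfolding z(1)[symmetric] by (simp add: x_def)
    also have "\<dots> = finprod K (\<lambda>i. act t (x i) [^]\<^bsub>K\<^esub> z i) {..<d}"
      using x by (intro abelian.coef_box_hom_finprod act_hom t) auto
    also have "\<dots> = finprod K (\<lambda>i. x (Suc i) [^]\<^bsub>K\<^esub> z i) {..<d}"
      using t a act_pow_Suc unfolding x_def by simp
    also have "\<dots> \<in> coef_box K x {..<d} (2 ^ n + 2 ^ n * 1)"
      using x rel z by (intro abelian.coef_box_shift) (auto simp: x_def)
    finally show ?case by simp
  qed
  then show ?thesis by (simp add: x_def)
qed

abbreviation box :: "'a set \<Rightarrow> real \<Rightarrow> 'a set" where
  "box F c \<equiv> coef_box K (\<lambda>f. f) F c"

text \<open>
  The subgroup generated by \<open>F\<close> when \<open>F\<close> is finite; this form keeps the exponent bounds at hand.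
\<close>

definition int_span :: "'a set \<Rightarrow> 'a set" where
  "int_span F = (\<Union>c. box F c)"

lemma span_generator: "finite F \<Longrightarrow> F \<subseteq> M \<Longrightarrow> f \<in> F \<Longrightarrow> f \<in> int_span F"
  using abelian.coef_box_generator[of "\<lambda>f. f" F f] unfolding int_span_def by auto

lemma span_uniform_bound:
  assumes "finite J" "\<And>j. j \<in> J \<Longrightarrow> u j \<in> int_span F"
  obtains C where "0 \<le> C" "\<And>j. j \<in> J \<Longrightarrow> u j \<in> box F C"
proof -
  obtain c where c: "\<And>j. j \<in> J \<Longrightarrow> u j \<in> box F (c j)"
  proof -
    have "\<forall>j\<in>J. \<exists>c. u j \<in> box F c" using assms(2) by (auto simp: int_span_def)
    from bchoice[OF this] show thesis using that by blast
  qed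
  have "u j \<in> box F (\<Sum>j\<in>J. \<bar>c j\<bar>)" if "j \<in> J" for j
  proof -
    have "c j \<le> \<bar>c j\<bar>" by simp
    also have "\<dots> \<le> (\<Sum>j\<in>J. \<bar>c j\<bar>)" using that assms(1) by (intro member_le_sum) auto
    finally show ?thesis using c[OF that] by (rule subsetD[OF coef_box_mono])
  qed
  then show thesis by (intro that[of "\<Sum>j\<in>J. \<bar>c j\<bar>"]) (auto intro: sum_nonneg)
qed

lemma span_hom:
  assumes "h \<in> hom K K" "finite I" "x \<in> I \<rightarrow> M" "F \<subseteq> M"
    and "\<And>i. i \<in> I \<Longrightarrow> h (x i) \<in> int_span F" "v \<in> coef_box K x I c"
  shows "h v \<in> int_span F"
proof -
  obtain C where "0 \<le> C" "\<And>i. i \<in> I \<Longrightarrow> h (x i) \<in> box F C"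
    using span_uniform_bound[of I "\<lambda>i. h (x i)" F] assms by blast
  then have "h v \<in> box F (real (card I) * (c * C))"
    using assms by (intro abelian.coef_box_hom[of h x I]) auto
  then show ?thesis unfolding int_span_def by blast
qed

lemma id_hom: "(\<lambda>x. x) \<in> hom K K"
  by (auto simp: hom_def)

lemma span_act:
  assumes "g \<in> carrier G" "finite F" "F \<subseteq> M" "F' \<subseteq> M"
    and "\<And>f. f \<in> F \<Longrightarrow> act g f \<in> int_span F'" and "v \<in> int_span F"
  shows "act g v \<in> int_span F'"
proof -
  obtain c where "v \<in> box F c" using assms(6) unfolding int_span_def by auto
  then show ?thesis
    using assms by (intro span_hom[OF act_hom, of g F "\<lambda>f. f" F' v c]) auto
qed

text \<open>
  One letter at a time: adjoining the first translates of the generators under a new letter makes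
  the span invariant under that letter by its monic relations, and the invariance under the earlier
  letters survives because the actions commute.
\<close>

lemma invariant_span_extension:
  assumes rel: "\<And>t a. t \<in> carrier G \<Longrightarrow> a \<in> M \<Longrightarrow> monic_relation t a"
    and "finite A" "A \<subseteq> carrier G" and Y: "finite Y" "Y \<subseteq> M"
  shows "\<exists>F. finite F \<and> Y \<subseteq> F \<and> F \<subseteq> M \<and> (\<forall>l\<in>A. \<forall>f\<in>F. act l f \<in> int_span F)"
  using assms(2,3)
proof (induct A)
  case empty
  then show ?case using Y by auto
next
  case (insert l A)
  then have l: "l \<in> carrier G" by simp
  have AG: "A \<subseteq> carrier G" using insert(4) by simp
  from insert(3)[OF AG] obtain F where F: "finite F" "Y \<subseteq> F" "F \<subseteq> M"
    and inv: "\<And>l f. l \<in> A \<Longrightarrow> f \<in> F \<Longrightarrow> act l f \<in> int_span F" by blast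
  have ex: "\<exists>d::nat. act (l [^] d) f \<in> coef_box K (\<lambda>i. act (l [^] i) f) {..<d} 1" if "f \<in> F" for f
    using rel[OF l, of f] F(3) that unfolding monic_relation_def by blast
  then obtain d :: "'a \<Rightarrow> nat"
    where d: "\<And>f. f \<in> F \<Longrightarrow> act (l [^] d f) f \<in> coef_box K (\<lambda>i. act (l [^] i) f) {..<d f} 1"
  proof -
    have "\<forall>f\<in>F. \<exists>d::nat. act (l [^] d) f \<in> coef_box K (\<lambda>i. act (l [^] i) f) {..<d} 1"
      using ex by simp
    from bchoice[OF this] show thesis using that by blast
  qed
  \<comment> \<open>The index \<open>d f\<close> is included so that \<open>f\<close> itself belongs to \<open>Z\<close> even when \<open>d f = 0\<close>.\<close>
  define Z where "Z = (\<Union>f\<in>F. (\<lambda>j::nat. act (l [^] j) f) ` {..d f})"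
  have Z: "finite Z" "Z \<subseteq> M" using F l unfolding Z_def by auto
  have "F \<subseteq> Z"
  proof
    fix f assume "f \<in> F"
    then have "f = act (l [^] (0::nat)) f" using F by auto
    then show "f \<in> Z" using \<open>f \<in> F\<close> unfolding Z_def by blast
  qed
  have orb: "act (l [^] j) f \<in> int_span Z" if f: "f \<in> F" for f and j :: nat
  proof (rule span_hom[OF id_hom, of "{..<d f}" "\<lambda>i. act (l [^] i) f"])
    show "act (l [^] j) f \<in> coef_box K (\<lambda>i. act (l [^] i) f) {..<d f} (2 ^ j)"
      by (rule orbit_coef_box) (use l f F d in auto)
    show "act (l [^] i) f \<in> int_span Z" if "i \<in> {..<d f}" for i
    proof (intro span_generator Z)
      have "act (l [^] i) f \<in> (\<lambda>j::nat. act (l [^] j) f) ` {..d f}"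
        using that by (intro image_eqI[where x = i]) auto
      with f show "act (l [^] i) f \<in> Z" unfolding Z_def by (rule UN_I)
    qed
  qed (use f F Z l in auto)
  have closed: "act g z \<in> int_span Z" if g: "g \<in> insert l A" and "z \<in> Z" for g z
  proof -
    obtain f j where z: "f \<in> F" "z = act (l [^] (j::nat)) f" using \<open>z \<in> Z\<close> unfolding Z_def by auto
    show ?thesis
    proof (cases "g = l")
      case True
      have "act g z = act (l [^] Suc j) f"
        unfolding z(2) True by (rule act_pow_Suc[symmetric]) (use z F l in auto)
      then show ?thesis using orb[OF z(1), of "Suc j"] by simp
    next
      case False
      with g have gA: "g \<in> A" by simp
      then have "g \<in> carrier G" using AG by blast
      then have "act g z = act (l [^] j) (act g f)"
        unfolding z(2) by (rule act_commute) (use z F l in auto)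
      moreover have "act (l [^] j) (act g f) \<in> int_span Z"
      proof (rule span_act[OF _ F(1,3) Z(2)])
        show "l [^] j \<in> carrier G" using l by simp
        show "act g f \<in> int_span F" by (rule inv[OF gA z(1)])
      qed (rule orb)
      ultimately show ?thesis by simp
    qed
  qed
  show ?case
  proof (intro exI[of _ Z] conjI ballI)
    show "Y \<subseteq> Z" using F(2) \<open>F \<subseteq> Z\<close> by (rule subset_trans)
  qed (fact Z closed)+
qed

text \<open>
  Exponents along an orbit grow slower than any exponential. A relation for \<open>t ^ k\<close> gives the bound
  \<open>2 ^ (n div k)\<close> over a family of generators that depends on \<open>k\<close>; rewriting that finite family in terms
  of the fixed set \<open>F\<close> costs only a constant factor. It is essential that \<open>F\<close> does not change with \<open>b\<close>,
  since the number of generators enters the final count as an exponent.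
\<close>

lemma orbit_growth:
  fixes b :: real
  assumes rel: "\<And>t a. t \<in> carrier G \<Longrightarrow> a \<in> M \<Longrightarrow> monic_relation t a"
    and F: "finite F" "F \<subseteq> M" and t: "t \<in> carrier G"
    and inv: "\<And>f. f \<in> F \<Longrightarrow> act t f \<in> int_span F"
    and a: "a \<in> F" and b: "1 < b"
  shows "\<exists>C\<ge>0. \<forall>n::nat. act (t [^] n) a \<in> box F (C * b ^ n)"
proof -
  have aM: "a \<in> M" using a F by auto
  have orb: "act (t [^] n) a \<in> int_span F" for n :: nat
  proof (induct n)
    case 0
    then show ?case using aM a F by (simp add: span_generator)
  next
    case (Suc n)
    then show ?case using span_act[OF t F F(2) inv] act_pow_Suc[OF t aM] by simp
  qed
  obtain k where k: "2 < b ^ k" using real_arch_pow[OF b] by blast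
  then have k0: "0 < k" by (intro gr0I) auto
  obtain d :: nat where d: "act ((t [^] k) [^] d) a \<in> coef_box K (\<lambda>i. act ((t [^] k) [^] i) a) {..<d} 1"
    using rel[of "t [^] k" a] t aM unfolding monic_relation_def by auto
  obtain C where C: "0 \<le> C" "\<And>j. j < k * d + k \<Longrightarrow> act (t [^] j) a \<in> box F C"
    using span_uniform_bound[of "{..<k * d + k}" "\<lambda>j. act (t [^] j) a" F] orb by auto
  have "act (t [^] n) a \<in> box F ((real d * C) * b ^ n)" for n :: nat
  proof -
    define q j where "q = n div k" and "j = n mod k"
    have n: "n = j + k * q" by (simp add: q_def j_def)
    have j: "j < k" using k0 by (simp add: j_def)
    have "act (t [^] n) a = act (t [^] j) (act ((t [^] k) [^] q) a)"
      unfolding n using t aM by (simp add: act_pow_add nat_pow_pow)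
    also have "\<dots> \<in> box F (real (card {..<d}) * (2 ^ q * C))"
    proof (rule abelian.coef_box_hom[where h = "act (t [^] j)"
            and x = "\<lambda>i. act ((t [^] k) [^] i) a"])
      show "act (t [^] j) \<in> hom K K" using t by (intro act_hom) auto
      show "act ((t [^] k) [^] q) a \<in> coef_box K (\<lambda>i. act ((t [^] k) [^] i) a) {..<d} (2 ^ q)"
        using d t aM by (intro orbit_coef_box) auto
      fix i assume i: "i \<in> {..<d}"
      have "act (t [^] j) (act ((t [^] k) [^] i) a) = act (t [^] (j + k * i)) a"
        using t aM by (simp add: act_pow_add nat_pow_pow)
      moreover have "k * i \<le> k * d" using i by simp
      then have "j + k * i < k * d + k" using j by linarith
      ultimately show "act (t [^] j) (act ((t [^] k) [^] i) a) \<in> box F C" using C(2) by simp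
    qed (use F C t aM in auto)
    also have "real (card {..<d}) * (2 ^ q * C) \<le> (real d * C) * b ^ n"
    proof -
      have "(2::real) ^ q \<le> (b ^ k) ^ q" using k by (intro power_mono) auto
      also have "\<dots> = b ^ (k * q)" by (simp add: power_mult)
      also have "\<dots> \<le> b ^ n" using b n by (intro power_increasing) auto
      finally show ?thesis using C(1) by (simp add: mult_left_mono mult.commute mult.left_commute)
    qed
    then have "box F (real (card {..<d}) * (2 ^ q * C)) \<subseteq> box F ((real d * C) * b ^ n)"
      by (rule coef_box_mono)
    finally show ?thesis .
  qed
  then show ?thesis using C(1) by (intro exI[of _ "real d * C"]) auto
qed

end

section \<open>Growth when every orbit satisfies a monic relation\<close>

context group begin

definition eval_word :: "'a list \<Rightarrow> 'a" where
  "eval_word w = foldr (\<otimes>) w \<one>"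

lemma eval_word_simps [simp]:
  "eval_word [] = \<one>" "eval_word (x # w) = x \<otimes> eval_word w"
  by (simp_all add: eval_word_def)

lemma eval_word_closed [simp]: "set w \<subseteq> carrier G \<Longrightarrow> eval_word w \<in> carrier G"
  by (induct w) auto

lemma eval_word_append:
  "set v \<subseteq> carrier G \<Longrightarrow> set w \<subseteq> carrier G \<Longrightarrow> eval_word (v @ w) = eval_word v \<otimes> eval_word w"
  by (induct v) (auto simp: m_assoc)

end

context metabelian_extension begin

text \<open>
  As the actions commute, all occurrences of one letter can be collected in front.
\<close>

lemma act_eval_word_separate:
  assumes "set w \<subseteq> carrier G" "l \<in> carrier G" "x \<in> M"
  shows "act (eval_word w) x
       = act (l [^] length (filter (\<lambda>y. y = l) w)) (act (eval_word (filter (\<lambda>y. y \<noteq> l) w)) x)"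
  using assms(1)
proof (induct w)
  case Nil
  then show ?case using assms by simp
next
  case (Cons y w)
  let ?m = "length (filter (\<lambda>y. y = l) w)" and ?v = "filter (\<lambda>y. y \<noteq> l) w"
  have v: "eval_word ?v \<in> carrier G" using Cons by (intro eval_word_closed) auto
  have *: "act (eval_word (y # w)) x = act y (act (l [^] ?m) (act (eval_word ?v) x))"
    using Cons assms v by (simp add: act_mult)
  then show ?case
  proof (cases "y = l")
    case True
    have "act (l [^] Suc ?m) (act (eval_word ?v) x) = act l (act (l [^] ?m) (act (eval_word ?v) x))"
      using assms v by (intro act_pow_Suc) auto
    with True * show ?thesis by simp
  next
    case False
    have "act y (act (l [^] ?m) (act (eval_word ?v) x)) = act (l [^] ?m) (act y (act (eval_word ?v) x))"
      using Cons assms v by (intro act_commute) auto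
    with False * show ?thesis using Cons assms v by (simp add: act_mult)
  qed
qed

text \<open>
  Only the numbers of occurrences of the letters matter for the action of a word, so the bounds for
  the powers of single letters multiply.
\<close>

lemma word_action_growth:
  fixes b :: real
  assumes rel: "\<And>t a. t \<in> carrier G \<Longrightarrow> a \<in> M \<Longrightarrow> monic_relation t a"
    and F: "finite F" "F \<subseteq> M" and L: "finite L" "L \<subseteq> carrier G"
    and inv: "\<And>l f. l \<in> L \<Longrightarrow> f \<in> F \<Longrightarrow> act l f \<in> int_span F"
    and b: "1 < b"
  shows "\<exists>C\<ge>0. \<forall>w\<in>lists L. \<forall>f\<in>F. act (eval_word w) f \<in> box F (C * b ^ length w)"
  using L inv
proof (induct L)
  case empty
  have "f \<in> box F 1" if "f \<in> F" for f
    using abelian.coef_box_generator[of "\<lambda>f. f" F f] F that by (auto simp: Pi_iff)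
  then show ?case using F by (intro exI[of _ 1]) auto
next
  case (insert l L)
  have LG: "L \<subseteq> carrier G" and l: "l \<in> carrier G" using insert(4) by auto
  obtain C where C: "0 \<le> C" "\<And>w f. w \<in> lists L \<Longrightarrow> f \<in> F \<Longrightarrow> act (eval_word w) f \<in> box F (C * b ^ length w)"
    using insert(3)[OF LG] insert(5) by blast
  have "\<forall>f\<in>F. \<exists>D\<ge>0. \<forall>n::nat. act (l [^] n) f \<in> box F (D * b ^ n)"
    using orbit_growth[OF rel F l _ _ b] insert(5) by simp
  from bchoice[OF this] obtain D where D0: "\<forall>f\<in>F. 0 \<le> D f \<and> (\<forall>n::nat. act (l [^] n) f \<in> box F (D f * b ^ n))"
    by blast
  define E where "E = sum D F"
  have E: "0 \<le> E" unfolding E_def using D0 by (intro sum_nonneg) auto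
  have D: "act (l [^] n) f \<in> box F (E * b ^ n)" if "f \<in> F" for f and n :: nat
  proof -
    have "D f \<le> E" unfolding E_def using D0 F that by (intro member_le_sum) auto
    then have "box F (D f * b ^ n) \<subseteq> box F (E * b ^ n)" using b by (intro coef_box_mono mult_right_mono) auto
    then show ?thesis using D0 that by blast
  qed
  have "act (eval_word w) f \<in> box F ((real (card F) * (C * E)) * b ^ length w)"
    if w: "w \<in> lists (insert l L)" and f: "f \<in> F" for w f
  proof -
    let ?m = "length (filter (\<lambda>y. y = l) w)" and ?v = "filter (\<lambda>y. y \<noteq> l) w"
    have len: "length w = length ?v + ?m"
      using sum_length_filter_compl[of "\<lambda>y. y = l" w] by simp
    have wG: "set w \<subseteq> carrier G" and v: "?v \<in> lists L" using w LG l by auto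
    have "act (eval_word w) f = act (l [^] ?m) (act (eval_word ?v) f)"
      using wG l f F by (intro act_eval_word_separate) auto
    also have "\<dots> \<in> box F (real (card F) * (C * b ^ length ?v * (E * b ^ ?m)))"
      by (rule abelian.coef_box_hom[where h = "act (l [^] ?m)" and x = "\<lambda>f. f"])
        (use F l b E D C(2)[OF v f] in \<open>auto intro!: act_hom\<close>)
    also have "real (card F) * (C * b ^ length ?v * (E * b ^ ?m)) = (real (card F) * (C * E)) * b ^ length w"
      unfolding len power_add by (simp add: ac_simps)
    finally show ?thesis .
  qed
  then show ?case using C(1) E by (intro exI[of _ "real (card F) * (C * E)"]) auto
qed

text \<open>
  Each transposition of neighbouring letters \<open>x y = [x, y] y x\<close> contributes the commutator conjugated by
  the prefix in front of it. Keeping a prefix \<open>p\<close> in the statement makes every contribution a single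
  conjugate of a commutator by a word of length at most \<open>N\<close>. Pulling factors out of a suffix and conjugating
  them afterwards by the letters in front would compound the bounds.
\<close>

lemma move_letter:
  assumes L: "L \<subseteq> carrier G" and F: "F \<subseteq> M" "finite F" and "0 \<le> D"
    and D: "\<And>w x y. w \<in> lists L \<Longrightarrow> length w \<le> N \<Longrightarrow> x \<in> L \<Longrightarrow> y \<in> L \<Longrightarrow>
              act (eval_word w) (x \<otimes> y \<otimes> inv x \<otimes> inv y) \<in> box F D"
    and "p \<in> lists L" "x \<in> L" "u \<in> lists L" "v \<in> lists L" "length p + length u \<le> N"
  shows "\<exists>m \<in> box F (real (length u) * D). eval_word (p @ x # u @ v) = m \<otimes> eval_word (p @ u @ x # v)"
  using assms(6-)
proof (induct u arbitrary: p)
  case Nil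
  have "eval_word (p @ x # v) \<in> carrier G" using Nil L by (intro eval_word_closed) auto
  moreover have "\<one> \<in> box F 0" using abelian.one_in_coef_box[of 0 "\<lambda>f. f" F] by simp
  ultimately show ?case by (intro bexI[of _ \<one>]) auto
next
  case (Cons y u)
  have sub: "set p \<subseteq> carrier G" "set u \<subseteq> carrier G" "set v \<subseteq> carrier G" "x \<in> carrier G" "y \<in> carrier G"
    using Cons L by auto
  define k where "k = x \<otimes> y \<otimes> inv x \<otimes> inv y"
  have k: "k \<in> M" "x \<otimes> y = k \<otimes> (y \<otimes> x)"
    using sub commutator_in commutator_swap unfolding k_def by auto
  have kG: "k \<in> carrier G" using k in_carrier by auto
  obtain m where m: "m \<in> box F (real (length u) * D)"
    "eval_word ((p @ [y]) @ x # u @ v) = m \<otimes> eval_word ((p @ [y]) @ u @ x # v)"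
    using Cons(1)[of "p @ [y]"] Cons(2-) by auto
  have k': "act (eval_word p) k \<in> box F D"
    unfolding k_def using Cons by (intro D) auto
  have mM: "m \<in> M" using m(1) abelian.coef_box_closed[of "\<lambda>f. f" F] F by auto
  define q where "q = eval_word (u @ v)"
  have q: "q \<in> carrier G" using sub unfolding q_def by simp
  let ?e = "eval_word p"
  have e: "?e \<in> carrier G" using sub by simp
  have "eval_word (p @ x # (y # u) @ v) = ?e \<otimes> (x \<otimes> y \<otimes> q)"
    using sub by (simp add: eval_word_append m_assoc q_def)
  also have "\<dots> = act ?e k \<otimes> (?e \<otimes> (y \<otimes> x \<otimes> q))"
  proof -
    have "inv ?e \<otimes> (?e \<otimes> (y \<otimes> (x \<otimes> q))) = y \<otimes> (x \<otimes> q)"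
      using e sub q by (simp add: m_assoc[symmetric])
    then show ?thesis unfolding act_def k(2) using e sub q kG by (simp add: m_assoc)
  qed
  also have "?e \<otimes> (y \<otimes> x \<otimes> q) = eval_word ((p @ [y]) @ x # u @ v)"
    using sub by (simp add: eval_word_append m_assoc q_def)
  also have "act ?e k \<otimes> \<dots> = (act ?e k \<otimes> m) \<otimes> eval_word (p @ (y # u) @ x # v)"
    unfolding m(2) using e k mM sub in_carrier by (simp add: m_assoc)
  finally have "eval_word (p @ x # (y # u) @ v) = (act ?e k \<otimes> m) \<otimes> eval_word (p @ (y # u) @ x # v)" .
  moreover have "act ?e k \<otimes> m \<in> box F (D + real (length u) * D)"
    using abelian.coef_box_mult[of "\<lambda>f. f" F "act ?e k" D m] k' m(1) F by auto
  ultimately show ?case by (intro bexI[of _ "act ?e k \<otimes> m"]) (auto simp: algebra_simps)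
qed

text \<open>
  Sorting a word by moving one letter after the other takes at most quadratically many
  transpositions.
\<close>

lemma permute_letters:
  assumes L: "L \<subseteq> carrier G" and F: "F \<subseteq> M" "finite F" and "0 \<le> D"
    and D: "\<And>w x y. w \<in> lists L \<Longrightarrow> length w \<le> N \<Longrightarrow> x \<in> L \<Longrightarrow> y \<in> L \<Longrightarrow>
              act (eval_word w) (x \<otimes> y \<otimes> inv x \<otimes> inv y) \<in> box F D"
    and "p \<in> lists L" "w \<in> lists L" "mset w = mset w'" "length p + length w \<le> N"
  shows "\<exists>m \<in> box F (real (length w) ^ 2 * D). eval_word (p @ w) = m \<otimes> eval_word (p @ w')"
  using assms(6-)
proof (induct w arbitrary: p w')
  case Nil
  then have "eval_word p \<in> carrier G" using L by (intro eval_word_closed) auto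
  moreover have "\<one> \<in> box F 0" using abelian.one_in_coef_box[of 0 "\<lambda>f. f" F] by simp
  ultimately show ?case using Nil by (intro bexI[of _ \<one>]) auto
next
  case (Cons x w)
  then have "x \<in> set w'" by (metis list.set_intros(1) set_mset_mset)
  then obtain u v where w': "w' = u @ x # v" by (meson split_list)
  have set_w': "set w' = set (x # w)" using Cons(4) by (metis set_mset_mset)
  have len: "length w' = length (x # w)" using Cons(4) by (metis size_mset)
  have "set w' \<subseteq> L" unfolding set_w' using Cons(3) by auto
  then have lists: "u \<in> lists L" "v \<in> lists L" "x \<in> L" "w \<in> lists L"
    using Cons(3) unfolding w' by auto
  have ms: "mset w = mset (u @ v)" using Cons(4) w' by simp
  obtain m where m: "m \<in> box F (real (length w) ^ 2 * D)"
    "eval_word ((p @ [x]) @ w) = m \<otimes> eval_word ((p @ [x]) @ u @ v)"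
    using Cons(1)[of "p @ [x]" "u @ v"] Cons(2-) ms by auto
  have "\<exists>k \<in> box F (real (length u) * D). eval_word (p @ x # u @ v) = k \<otimes> eval_word (p @ u @ x # v)"
    by (rule move_letter[OF L F assms(4) D]) (use Cons(2,5) lists len w' in auto)
  then obtain k where k: "k \<in> box F (real (length u) * D)"
    "eval_word (p @ x # u @ v) = k \<otimes> eval_word (p @ u @ x # v)" by blast
  have box_M: "box F c \<subseteq> M" for c using abelian.coef_box_closed[of "\<lambda>f. f" F] F by auto
  have "m \<otimes> k \<in> box F (real (length w) ^ 2 * D + real (length u) * D)"
    using abelian.coef_box_mult[of "\<lambda>f. f" F m _ k] m k F by auto
  moreover have "real (length w) ^ 2 * D + real (length u) * D \<le> real (length (x # w)) ^ 2 * D"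
  proof -
    have "real (length u) \<le> real (length w)" using len w' by simp
    then have "real (length w) ^ 2 + real (length u) \<le> real (length (x # w)) ^ 2"
      by (simp add: power2_eq_square algebra_simps)
    then show ?thesis using assms(4) by (metis distrib_right mult_right_mono)
  qed
  ultimately have "m \<otimes> k \<in> box F (real (length (x # w)) ^ 2 * D)"
    by (metis coef_box_mono subsetD)
  moreover have "eval_word (p @ x # w) = (m \<otimes> k) \<otimes> eval_word (p @ w')"
  proof -
    have "m \<in> carrier G" "k \<in> carrier G"
      using subsetD[OF box_M m(1)] subsetD[OF box_M k(1)] in_carrier by auto
    moreover have "eval_word (p @ w') \<in> carrier G"
      using \<open>set w' \<subseteq> L\<close> Cons(2) L by (intro eval_word_closed) auto
    ultimately show ?thesis using m(2) k(2) w' by (simp add: m_assoc)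
  qed
  ultimately show ?case by blast
qed

end
text \<open>
  The exponents \<open>p\<close> and \<open>q\<close> are fixed before \<open>b\<close> is chosen, so \<open>b\<close> can be taken so small that \<open>b ^ q\<close>
  is below \<open>a\<close>, with enough room left to absorb the polynomial factors.
\<close>

lemma exponential_not_dominated:
  fixes a :: real and p q :: nat
  assumes "1 < a"
    and bound: "\<And>b. 1 < b \<Longrightarrow> \<exists>C\<ge>0. \<forall>n::nat.
      a ^ n \<le> (real n + 1) ^ p * (2 * (real n ^ 2 * (C * b ^ n)) + 1) ^ q"
  shows False
proof -
  define k where "k = p + 2 * q + 1"
  \<comment> \<open>With this choice \<open>a ^ n\<close> splits as \<open>b ^ (n * q)\<close> times \<open>b ^ (n * k)\<close>; the first factor cancels against the right-hand side, and \<open>k\<close> exceeds the degree \<open>p + 2 * q\<close> of what remains.\<close>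
  define b where "b = root (q + k) a"
  have b: "1 < b" "b ^ (q + k) = a"
    unfolding b_def using assms(1) by (simp add: k_def, intro real_root_pow_pos2) (auto simp: k_def)
  obtain C where C: "0 \<le> C"
    and le: "\<And>n::nat. a ^ n \<le> (real n + 1) ^ p * (2 * (real n ^ 2 * (C * b ^ n)) + 1) ^ q"
    using bound[OF b(1)] by blast
  define c where "c = 1 / b"
  have c: "0 < c" "c < 1" using b by (simp_all add: c_def)
  \<comment> \<open>As \<open>b ^ n\<close> outgrows \<open>n + 1\<close>, some \<open>n\<close> violates the comparison that is derived below.\<close>
  have "(\<lambda>n. real n * c ^ n + c ^ n) \<longlonglongrightarrow> 0 + 0"
    using c by (intro tendsto_add powser_times_n_limit_0 LIMSEQ_power_zero) auto
  then have "\<forall>\<^sub>F n in sequentially. real n * c ^ n + c ^ n < 1 / (1 + (2 * C + 1) ^ q)"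
    by (rule order_tendstoD(2)) (use C in \<open>simp add: add_pos_nonneg\<close>)
  then obtain n :: nat where n: "real n * c ^ n + c ^ n < 1 / (1 + (2 * C + 1) ^ q)"
    unfolding eventually_sequentially by blast
  define y where "y = real n + 1"
  have y: "1 \<le> y" "0 < b ^ n" using b by (simp_all add: y_def)
  have "y * c ^ n < 1 / (1 + (2 * C + 1) ^ q)" using n by (simp add: y_def algebra_simps)
  then have "y * (1 + (2 * C + 1) ^ q) < b ^ n"
    using y C by (simp add: c_def field_simps add_pos_nonneg)
  then have big: "1 + (2 * C + 1) ^ q < b ^ n / y" using y by (simp add: field_simps)
  have "2 * (real n ^ 2 * (C * b ^ n)) + 1 \<le> (2 * C + 1) * (y ^ 2 * b ^ n)"
  proof -
    have "real n ^ 2 * (C * b ^ n) \<le> y ^ 2 * (C * b ^ n)"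
      using C y by (intro mult_right_mono power_mono) (auto simp: y_def)
    moreover have "1 * 1 \<le> y ^ 2 * b ^ n"
      using y b by (intro mult_mono one_le_power) auto
    ultimately show ?thesis by (simp add: algebra_simps)
  qed
  then have "(2 * (real n ^ 2 * (C * b ^ n)) + 1) ^ q \<le> ((2 * C + 1) * (y ^ 2 * b ^ n)) ^ q"
    using C y by (intro power_mono) auto
  then have "y ^ p * (2 * (real n ^ 2 * (C * b ^ n)) + 1) ^ q \<le> y ^ p * ((2 * C + 1) * (y ^ 2 * b ^ n)) ^ q"
    using y by (intro mult_left_mono) auto
  then have "a ^ n \<le> y ^ p * ((2 * C + 1) * (y ^ 2 * b ^ n)) ^ q"
    by (rule order_trans[OF le[of n, folded y_def]])
  also have "\<dots> = (2 * C + 1) ^ q * y ^ (p + 2 * q) * (b ^ n) ^ q"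
  proof -
    have "y ^ p * (E * (y ^ 2 * B)) ^ q = E ^ q * y ^ (p + 2 * q) * B ^ q" for E B :: real
      by (simp add: power_mult_distrib power_add ac_simps flip: power_mult)
    then show ?thesis .
  qed
  also have "\<dots> \<le> (2 * C + 1) ^ q * y ^ k * (b ^ n) ^ q"
    using y C by (intro mult_right_mono mult_left_mono power_increasing) (auto simp: k_def)
  also have "a ^ n = (b ^ n) ^ k * (b ^ n) ^ q"
    unfolding b(2)[symmetric] by (simp add: power_mult[symmetric] power_add[symmetric] algebra_simps)
  finally have "(b ^ n) ^ k \<le> (2 * C + 1) ^ q * y ^ k" using y by simp
  then have "(b ^ n / y) ^ k \<le> (2 * C + 1) ^ q" using y by (simp add: power_divide field_simps)
  moreover have "b ^ n / y \<le> (b ^ n / y) ^ k"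
    using big C by (intro self_le_power) (auto simp: k_def intro: order_trans[of 1 "1 + (2 * C + 1) ^ q"])
  ultimately show False using big by linarith
qed

context metabelian_extension begin

text \<open>
  Up to a factor from a box, an element represented by a word is determined by how often each letter
  occurs, for which there are only polynomially many possibilities.
\<close>

lemma finite_card_words:
  fixes b :: real
  assumes F: "finite F" "F \<subseteq> M" and L: "finite L" "L \<subseteq> carrier G" and "0 \<le> D"
    and D: "\<And>w x y. w \<in> lists L \<Longrightarrow> length w \<le> n \<Longrightarrow> x \<in> L \<Longrightarrow> y \<in> L \<Longrightarrow>
              act (eval_word w) (x \<otimes> y \<otimes> inv x \<otimes> inv y) \<in> box F D"
  shows "real (card (eval_word ` {w \<in> lists L. length w = n}))
       \<le> (real n + 1) ^ card L * (2 * (real n ^ 2 * D) + 1) ^ card F"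
proof -
  let ?W = "{w \<in> lists L. length w = n}" and ?P = "L \<rightarrow>\<^sub>E {0..n}"
  let ?B = "box F (real n ^ 2 * D)"
  define letters where "letters w = restrict (count (mset w)) L" for w :: "'a list"
  \<comment> \<open>A word chosen once and for all for each admissible vector of multiplicities.\<close>
  define rep where "rep c = (SOME w. w \<in> ?W \<and> letters w = c)" for c
  have cover: "eval_word ` ?W \<subseteq> (\<lambda>(m, c). m \<otimes> eval_word (rep c)) ` (?B \<times> ?P)"
  proof
    fix g assume "g \<in> eval_word ` ?W"
    then obtain w where w: "w \<in> lists L" "length w = n" "g = eval_word w" by auto
    have "rep (letters w) \<in> ?W \<and> letters (rep (letters w)) = letters w"
      unfolding rep_def
      by (rule someI[of "\<lambda>v. v \<in> ?W \<and> letters v = letters w" w]) (use w in simp)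
    then obtain v where v: "v = rep (letters w)" "v \<in> lists L" "length v = n" "letters v = letters w"
      by blast
    have "count (mset w) x = count (mset v) x" for x
    proof (cases "x \<in> L")
      case True
      then show ?thesis using fun_cong[OF v(4), of x] by (simp add: letters_def)
    next
      case False
      then have "x \<notin> set w" "x \<notin> set v" using w v by auto
      then show ?thesis by (metis count_eq_zero_iff set_mset_mset)
    qed
    then have "mset w = mset v" by (rule multiset_eqI)
    then have "\<exists>m \<in> box F (real (length w) ^ 2 * D). eval_word ([] @ w) = m \<otimes> eval_word ([] @ v)"
      using w by (intro permute_letters[OF L(2) F(2,1) assms(5) D]) auto
    then obtain m where "m \<in> ?B" "g = m \<otimes> eval_word v" using w by auto
    moreover have "count (mset w) x \<le> n" for x
      using count_le_size[of "mset w" x] w by simp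
    then have "letters w \<in> ?P" by (auto simp: letters_def)
    ultimately show "g \<in> (\<lambda>(m, c). m \<otimes> eval_word (rep c)) ` (?B \<times> ?P)" using v(1) by auto
  qed
  have B: "finite ?B" "real (card ?B) \<le> (2 * (real n ^ 2 * D) + 1) ^ card F"
    using abelian.finite_card_coef_box[of "\<lambda>f. f" F "real n ^ 2 * D"] F assms(5) by auto
  have P: "finite ?P" "card ?P = (n + 1) ^ card L"
    using L by (auto intro: finite_PiE simp: card_PiE)
  have "finite (?B \<times> ?P)" using B(1) P(1) by (rule finite_cartesian_product)
  from surj_card_le[OF this cover]
  have "real (card (eval_word ` ?W)) \<le> real (card (?B \<times> ?P))" by (simp only: of_nat_le_iff)
  also have "\<dots> = real (card ?B) * real (card ?P)"
    by (simp only: card_cartesian_product of_nat_mult)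
  also have "\<dots> \<le> (2 * (real n ^ 2 * D) + 1) ^ card F * real (card ?P)"
    using B by (intro mult_right_mono) auto
  finally show ?thesis using P by (simp add: algebra_simps)
qed

text \<open>
  A finite set \<open>F\<close> containing the commutators of the letters and spanning an invariant subgroup
  provides the boxes. Their side length is \<open>n\<^sup>2 * (C * b ^ n)\<close>, where \<open>C\<close> depends on \<open>b\<close> but \<open>F\<close> does not.
\<close>

lemma exponential_growth_excludes_monic_relations:
  assumes rel: "\<And>t a. t \<in> carrier G \<Longrightarrow> a \<in> M \<Longrightarrow> monic_relation t a"
    and L: "finite L" "L \<subseteq> carrier G" and "1 < a"
    and growth: "\<And>n. a ^ n \<le> real (card (eval_word ` {w \<in> lists L. length w = n}))"
  shows False
proof -
  define Y where "Y = (\<lambda>(x, y). x \<otimes> y \<otimes> inv x \<otimes> inv y) ` (L \<times> L)"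
  have Y: "finite Y" "Y \<subseteq> M" using L commutator_in unfolding Y_def by auto
  obtain F where F: "finite F" "Y \<subseteq> F" "F \<subseteq> M"
    and inv: "\<And>l f. l \<in> L \<Longrightarrow> f \<in> F \<Longrightarrow> act l f \<in> int_span F"
    using invariant_span_extension[OF rel L Y] by blast
  show False
  proof (rule exponential_not_dominated[OF \<open>1 < a\<close>, of "card L" "card F"])
    fix b :: real assume b: "1 < b"
    obtain C where C: "0 \<le> C"
      and act: "\<And>w f. w \<in> lists L \<Longrightarrow> f \<in> F \<Longrightarrow> act (eval_word w) f \<in> box F (C * b ^ length w)"
      using word_action_growth[OF rel F(1,3) L inv b] by blast
    have "a ^ n \<le> (real n + 1) ^ card L * (2 * (real n ^ 2 * (C * b ^ n)) + 1) ^ card F" for n :: nat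
    proof -
      have "act (eval_word w) (x \<otimes> y \<otimes> inv x \<otimes> inv y) \<in> box F (C * b ^ n)"
        if w: "w \<in> lists L" "length w \<le> n" and xy: "x \<in> L" "y \<in> L" for w x y
      proof -
        have k: "x \<otimes> y \<otimes> inv x \<otimes> inv y \<in> F" using F(2) xy unfolding Y_def by auto
        have "C * b ^ length w \<le> C * b ^ n"
          using C b w by (intro mult_left_mono power_increasing) auto
        then show ?thesis by (rule subsetD[OF coef_box_mono act[OF w(1) k]])
      qed
      then have "real (card (eval_word ` {w \<in> lists L. length w = n}))
          \<le> (real n + 1) ^ card L * (2 * (real n ^ 2 * (C * b ^ n)) + 1) ^ card F"
        using C b by (intro finite_card_words F L) auto
      then show ?thesis using growth[of n] by linarith
    qed
    then show "\<exists>C\<ge>0. \<forall>n::nat.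
        a ^ n \<le> (real n + 1) ^ card L * (2 * (real n ^ 2 * (C * b ^ n)) + 1) ^ card F"
      using C by blast
  qed
qed

end

section \<open>Injective maps between Cayley graphs\<close>

lemma awalk_relpow:
  assumes "pair_wf_digraph A"
  shows "(\<exists>p. pre_digraph.awalk (with_proj A) x p y \<and> length p = n) \<longleftrightarrow>
         x \<in> pverts A \<and> (x, y) \<in> parcs A ^^ n"
proof -
  interpret pair_wf_digraph A by fact
  show ?thesis
  proof (induct n arbitrary: x)
    case 0
    then show ?case by (auto simp: awalk_Nil_iff)
  next
    case (Suc n)
    have "(\<exists>p. awalk x p y \<and> length p = Suc n)
        \<longleftrightarrow> (\<exists>z. (x, z) \<in> parcs A \<and> (\<exists>p. awalk z p y \<and> length p = n))"
    proof
      assume "\<exists>p. awalk x p y \<and> length p = Suc n"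
      then obtain e p where "awalk x (e # p) y" "length p = n" by (auto simp: length_Suc_conv)
      then show "\<exists>z. (x, z) \<in> parcs A \<and> (\<exists>p. awalk z p y \<and> length p = n)"
        by (cases e) (auto simp: awalk_Cons_iff)
    next
      assume "\<exists>z. (x, z) \<in> parcs A \<and> (\<exists>p. awalk z p y \<and> length p = n)"
      then obtain z p where "(x, z) \<in> parcs A" "awalk z p y" "length p = n" by blast
      then show "\<exists>p. awalk x p y \<and> length p = Suc n"
        by (intro exI[of _ "(x, z) # p"]) (auto simp: awalk_Cons_iff)
    qed
    also have "\<dots> \<longleftrightarrow> (\<exists>z. (x, z) \<in> parcs A \<and> (z, y) \<in> parcs A ^^ n)"
      using Suc in_arcsD2 by blast
    also have "\<dots> \<longleftrightarrow> x \<in> pverts A \<and> (x, y) \<in> parcs A ^^ Suc n"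
      using in_arcsD1 by (blast intro: relpow_Suc_I2 elim: relpow_Suc_E2)
    finally show ?case .
  qed
qed

lemma graph_dist_INF:
  assumes "pair_wf_digraph A"
  shows "graph_dist A x y = (INF n\<in>{n. x \<in> pverts A \<and> (x, y) \<in> parcs A ^^ n}. ereal (real n))"
proof -
  interpret pair_wf_digraph A by fact
  have len: "awalk_cost (\<lambda>_. 1) p = real (length p)" for p :: "('a \<times> 'a) list"
    by (induct p) auto
  have "{n. x \<in> pverts A \<and> (x, y) \<in> parcs A ^^ n} = length ` {p. awalk x p y}"
    unfolding awalk_relpow[OF assms, of x y, symmetric] by auto
  then show ?thesis
    unfolding graph_dist_def \<mu>_def by (simp add: len image_image)
qed

text \<open>
  The infimum of a nonempty set of walk lengths is attained, so distances can be handled through the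
  powers of the edge relation.
\<close>

lemma graph_dist_cases:
  assumes "pair_wf_digraph A"
  obtains "graph_dist A x y = \<infinity>"
  | n where "graph_dist A x y = ereal (real n)" "x \<in> pverts A" "(x, y) \<in> parcs A ^^ n"
proof (cases "\<exists>n. x \<in> pverts A \<and> (x, y) \<in> parcs A ^^ n")
  case False
  then have "{n. x \<in> pverts A \<and> (x, y) \<in> parcs A ^^ n} = {}" by blast
  then have "graph_dist A x y = \<infinity>"
    unfolding graph_dist_INF[OF assms] by (simp only: image_empty Inf_empty top_ereal_def)
  then show thesis by (rule that(1))
next
  case True
  define n where "n = (LEAST n. x \<in> pverts A \<and> (x, y) \<in> parcs A ^^ n)"
  have n: "x \<in> pverts A \<and> (x, y) \<in> parcs A ^^ n" unfolding n_def using True by (rule LeastI_ex)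
  have "graph_dist A x y = ereal (real n)"
    unfolding graph_dist_INF[OF assms]
  proof (rule antisym)
    show "ereal (real n) \<le> (INF n\<in>{n. x \<in> pverts A \<and> (x, y) \<in> parcs A ^^ n}. ereal (real n))"
      by (rule INF_greatest) (auto simp: n_def intro: Least_le)
  qed (use n in \<open>auto intro: INF_lower\<close>)
  then show thesis using that(2) n by blast
qed

lemma graph_dist_le:
  assumes "pair_wf_digraph A" "x \<in> pverts A" "(x, y) \<in> parcs A ^^ n"
  shows "graph_dist A x y \<le> ereal (real n)"
  unfolding graph_dist_INF[OF assms(1)] using assms(2,3) by (intro INF_lower) auto

lemma graph_map_lipschitz:
  assumes A: "pair_wf_digraph A" and B: "pair_wf_digraph B"
    and verts: "\<And>x. x \<in> pverts A \<Longrightarrow> \<phi> x \<in> pverts B"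
    and edges: "\<And>x y. (x, y) \<in> parcs A \<Longrightarrow> \<exists>k\<le>K. (\<phi> x, \<phi> y) \<in> parcs B ^^ k"
    and x: "x \<in> pverts A"
  shows "graph_dist B (\<phi> x) (\<phi> y) \<le> ereal (real (Suc K)) * graph_dist A x y"
  using A
proof (cases rule: graph_dist_cases[of A x y])
  case 1
  then show ?thesis by simp
next
  case (2 n)
  have "\<exists>k\<le>n * K. (\<phi> x, \<phi> y) \<in> parcs B ^^ k"
    using 2(3)
  proof (induct n arbitrary: y)
    case (Suc n)
    then obtain z where z: "(x, z) \<in> parcs A ^^ n" "(z, y) \<in> parcs A" by auto
    obtain k where k: "k \<le> n * K" "(\<phi> x, \<phi> z) \<in> parcs B ^^ k" using Suc(1)[OF z(1)] by blast
    obtain l where l: "l \<le> K" "(\<phi> z, \<phi> y) \<in> parcs B ^^ l" using edges[OF z(2)] by blast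
    have "(\<phi> x, \<phi> y) \<in> parcs B ^^ (k + l)" using k(2) l(2) by (rule relpow_trans)
    then show ?case using k(1) l(1) by (intro exI[of _ "k + l"]) auto
  qed auto
  then obtain k where k: "k \<le> n * K" "(\<phi> x, \<phi> y) \<in> parcs B ^^ k" by blast
  have "graph_dist B (\<phi> x) (\<phi> y) \<le> ereal (real k)" by (rule graph_dist_le[OF B verts[OF x] k(2)])
  also have "real k \<le> real (Suc K) * real n"
    using k(1) by (metis mult.commute mult_Suc_right nat_le_linear le_add2 le_trans of_nat_le_iff of_nat_mult)
  then have "ereal (real k) \<le> ereal (real (Suc K)) * graph_dist A x y" using 2 by simp
  finally show ?thesis .
qed

context group begin

lemma pair_wf_digraph_Cayley_graph: "pair_wf_digraph (Cayley_graph G S)"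
  by unfold_locales (auto simp: Cayley_graph_def)

lemma Cayley_arc:
  assumes "x \<in> carrier G" "s \<in> carrier G" "s \<in> S \<or> inv s \<in> S"
  shows "\<exists>k\<le>1. (x, x \<otimes> s) \<in> parcs (Cayley_graph G S) ^^ k"
proof (cases "x \<otimes> s = x")
  case True
  then show ?thesis by (intro exI[of _ 0]) auto
next
  case False
  have "x = (x \<otimes> s) \<otimes> inv s" using assms by (simp add: m_assoc)
  then have "(x, x \<otimes> s) \<in> parcs (Cayley_graph G S)"
    using False assms unfolding Cayley_graph_def by auto
  then show ?thesis by (intro exI[of _ 1]) auto
qed

lemma Cayley_path_generate:
  assumes "S \<subseteq> carrier G" "g \<in> generate G S"
  shows "\<exists>n. \<forall>x\<in>carrier G. \<exists>k\<le>n. (x, x \<otimes> g) \<in> parcs (Cayley_graph G S) ^^ k"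
  using assms(2)
proof (induct rule: generate.induct)
  case one
  then show ?case by (intro exI[of _ 0]) auto
next
  case (incl h)
  then show ?case using assms(1) Cayley_arc[of _ h S] by blast
next
  case (inv h)
  then show ?case using assms(1) Cayley_arc[of _ "inv h" S] by (metis inv_closed inv_inv subsetD)
next
  case (eng g h)
  then obtain m n where
    m: "\<And>x. x \<in> carrier G \<Longrightarrow> \<exists>k\<le>m. (x, x \<otimes> g) \<in> parcs (Cayley_graph G S) ^^ k" and
    n: "\<And>x. x \<in> carrier G \<Longrightarrow> \<exists>k\<le>n. (x, x \<otimes> h) \<in> parcs (Cayley_graph G S) ^^ k" by blast
  have gh: "g \<in> carrier G" "h \<in> carrier G" using eng assms(1) generate_in_carrier by auto
  have "\<exists>k\<le>m + n. (x, x \<otimes> (g \<otimes> h)) \<in> parcs (Cayley_graph G S) ^^ k" if x: "x \<in> carrier G" for x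
  proof -
    obtain k where k: "k \<le> m" "(x, x \<otimes> g) \<in> parcs (Cayley_graph G S) ^^ k" using m[OF x] by blast
    have xg: "x \<otimes> g \<in> carrier G" using x gh by simp
    obtain l where l: "l \<le> n" "(x \<otimes> g, x \<otimes> g \<otimes> h) \<in> parcs (Cayley_graph G S) ^^ l"
      using n[OF xg] by blast
    have "(x, x \<otimes> g \<otimes> h) \<in> parcs (Cayley_graph G S) ^^ (k + l)"
      using k(2) l(2) by (rule relpow_trans)
    then show ?thesis
      using k(1) l(1) gh x by (intro exI[of _ "k + l"]) (auto simp: m_assoc)
  qed
  then show ?case by blast
qed

text \<open>
  The identity is admitted as a letter to pad shorter words, so that all words have length exactly
  \<open>n\<close>.
\<close>

lemma Cayley_ball_words:
  assumes S: "S \<subseteq> carrier G"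
  defines "L \<equiv> insert \<one> (S \<union> m_inv G ` S)"
  shows "Cayley_ball G S n \<subseteq> eval_word ` {w \<in> lists L. length w = n}"
proof
  fix g assume g: "g \<in> Cayley_ball G S n"
  have L: "L \<subseteq> carrier G" using S unfolding L_def by auto
  have "\<exists>k\<le>n. (\<one>, g) \<in> parcs (Cayley_graph G S) ^^ k"
    using pair_wf_digraph_Cayley_graph
  proof (cases rule: graph_dist_cases[of "Cayley_graph G S" \<one> g])
    case 1
    then show ?thesis using g by (simp add: Cayley_ball_def)
  next
    case (2 k)
    then show ?thesis using g by (intro exI[of _ k]) (simp add: Cayley_ball_def)
  qed
  then obtain k where k: "k \<le> n" "(\<one>, g) \<in> parcs (Cayley_graph G S) ^^ k" by blast
  have "\<exists>w \<in> lists L. length w = k \<and> eval_word w = g"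
    using k(2)
  proof (induct k arbitrary: g)
    case (Suc k)
    then obtain h where h: "(\<one>, h) \<in> parcs (Cayley_graph G S) ^^ k" "(h, g) \<in> parcs (Cayley_graph G S)"
      by auto
    obtain w where w: "w \<in> lists L" "length w = k" "eval_word w = h" using Suc(1)[OF h(1)] by blast
    from h(2) obtain s where s: "s \<in> S" "h \<in> carrier G" "g \<in> carrier G" "g = h \<otimes> s \<or> h = g \<otimes> s"
      unfolding Cayley_graph_def by auto
    then have "g = h \<otimes> s \<or> g = h \<otimes> inv s" using S by (auto simp: m_assoc)
    then obtain l where l: "l \<in> L" "g = h \<otimes> l" using s(1) unfolding L_def by blast
    have "eval_word (w @ [l]) = g"
      using w l L by (subst eval_word_append) auto
    then show ?case using w l by (intro bexI[of _ "w @ [l]"]) auto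
  qed auto
  then obtain w where w: "w \<in> lists L" "length w = k" "eval_word w = g" by blast
  have "eval_word (replicate m \<one>) = \<one>" for m by (induct m) auto
  moreover have "g \<in> carrier G" using g by (simp add: Cayley_ball_def)
  ultimately have "eval_word (w @ replicate (n - k) \<one>) = g"
    using w L by (subst eval_word_append) auto
  moreover have "w @ replicate (n - k) \<one> \<in> lists L" using w unfolding L_def by auto
  ultimately show "g \<in> eval_word ` {w \<in> lists L. length w = n}"
    using w(2) k(1) by (intro image_eqI[of _ _ "w @ replicate (n - k) \<one>"]) auto
qed

end

text \<open>
  A map is Lipschitz for the word metrics if and only if, for each \<open>h\<close>, right multiplication by \<open>h\<close>
  displaces its values by finitely many elements. In this form the condition passes from a set of
  generators to products and inverses.
\<close>

lemma finite_displacement_generate: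
  fixes H :: "('c, 'd) monoid_scheme" and G :: "('a, 'b) monoid_scheme"
  assumes "group H" "group G" and \<psi>: "\<psi> \<in> carrier H \<rightarrow> carrier G" and S: "S \<subseteq> carrier H"
    and disp: "\<And>s. s \<in> S \<Longrightarrow> \<exists>E. finite E \<and> E \<subseteq> carrier G \<and>
      (\<forall>x\<in>carrier H. inv\<^bsub>G\<^esub> (\<psi> x) \<otimes>\<^bsub>G\<^esub> \<psi> (x \<otimes>\<^bsub>H\<^esub> s) \<in> E)"
    and "h \<in> generate H S"
  shows "\<exists>E. finite E \<and> E \<subseteq> carrier G \<and>
      (\<forall>x\<in>carrier H. inv\<^bsub>G\<^esub> (\<psi> x) \<otimes>\<^bsub>G\<^esub> \<psi> (x \<otimes>\<^bsub>H\<^esub> h) \<in> E)"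
  using assms(6)
proof (induct rule: generate.induct)
  interpret H: group H by fact
  interpret G: group G by fact
  have c: "\<psi> x \<in> carrier G" if "x \<in> carrier H" for x using \<psi> that by auto
  {
    case one
    show ?case using c by (intro exI[of _ "{\<one>\<^bsub>G\<^esub>}"]) auto
  next
    case (incl h)
    then show ?case by (rule disp)
  next
    case (inv h)
    obtain E where E: "finite E" "E \<subseteq> carrier G"
      "\<And>x. x \<in> carrier H \<Longrightarrow> inv\<^bsub>G\<^esub> (\<psi> x) \<otimes>\<^bsub>G\<^esub> \<psi> (x \<otimes>\<^bsub>H\<^esub> h) \<in> E"
      using disp[OF inv] by blast
    have h: "h \<in> carrier H" using inv S by auto
    have "inv\<^bsub>G\<^esub> (\<psi> x) \<otimes>\<^bsub>G\<^esub> \<psi> (x \<otimes>\<^bsub>H\<^esub> inv\<^bsub>H\<^esub> h) \<in> m_inv G ` E" if x: "x \<in> carrier H" for x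
    proof -
      let ?y = "x \<otimes>\<^bsub>H\<^esub> inv\<^bsub>H\<^esub> h"
      have y: "?y \<in> carrier H" "?y \<otimes>\<^bsub>H\<^esub> h = x" using x h by (auto simp: H.m_assoc)
      have "inv\<^bsub>G\<^esub> (\<psi> ?y) \<otimes>\<^bsub>G\<^esub> \<psi> x \<in> E" using E(3)[OF y(1)] y(2) by simp
      then have "inv\<^bsub>G\<^esub> (inv\<^bsub>G\<^esub> (\<psi> ?y) \<otimes>\<^bsub>G\<^esub> \<psi> x) \<in> m_inv G ` E" by (rule imageI)
      then show ?thesis using c[OF x] c[OF y(1)] by (simp add: G.inv_mult_group)
    qed
    then show ?case using E by (intro exI[of _ "m_inv G ` E"]) auto
  next
    case (eng h k)
    obtain E where E: "finite E" "E \<subseteq> carrier G"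
      "\<And>x. x \<in> carrier H \<Longrightarrow> inv\<^bsub>G\<^esub> (\<psi> x) \<otimes>\<^bsub>G\<^esub> \<psi> (x \<otimes>\<^bsub>H\<^esub> h) \<in> E"
      using eng(2) by blast
    obtain E' where E': "finite E'" "E' \<subseteq> carrier G"
      "\<And>x. x \<in> carrier H \<Longrightarrow> inv\<^bsub>G\<^esub> (\<psi> x) \<otimes>\<^bsub>G\<^esub> \<psi> (x \<otimes>\<^bsub>H\<^esub> k) \<in> E'"
      using eng(4) by blast
    have hk: "h \<in> carrier H" "k \<in> carrier H" using eng(1,3) S H.generate_in_carrier by auto
    let ?E = "(\<lambda>(e, f). e \<otimes>\<^bsub>G\<^esub> f) ` (E \<times> E')"
    have "inv\<^bsub>G\<^esub> (\<psi> x) \<otimes>\<^bsub>G\<^esub> \<psi> (x \<otimes>\<^bsub>H\<^esub> (h \<otimes>\<^bsub>H\<^esub> k)) \<in> ?E" if x: "x \<in> carrier H" for x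
    proof -
      let ?y = "x \<otimes>\<^bsub>H\<^esub> h"
      have y: "?y \<in> carrier H" "?y \<otimes>\<^bsub>H\<^esub> k \<in> carrier H" using x hk by auto
      have "inv\<^bsub>G\<^esub> (\<psi> x) \<otimes>\<^bsub>G\<^esub> \<psi> (?y \<otimes>\<^bsub>H\<^esub> k)
          = (inv\<^bsub>G\<^esub> (\<psi> x) \<otimes>\<^bsub>G\<^esub> \<psi> ?y) \<otimes>\<^bsub>G\<^esub> (inv\<^bsub>G\<^esub> (\<psi> ?y) \<otimes>\<^bsub>G\<^esub> \<psi> (?y \<otimes>\<^bsub>H\<^esub> k))"
        using c[OF x] c[OF y(1)] c[OF y(2)]
        by (simp add: G.m_assoc) (simp add: G.m_assoc[symmetric])
      moreover have "\<dots> \<in> ?E" using E(3)[OF x] E'(3)[OF y(1)] by auto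
      ultimately show ?thesis using x hk by (simp add: H.m_assoc)
    qed
    then show ?case using E E' by (intro exI[of _ ?E]) auto
  }
qed

text \<open>
  Regularity has to be shown for all finite generating sets, but it is enough to control the
  displacement for one of them.
\<close>

lemma inj_regular_group_map:
  fixes H :: "('c, 'd) monoid_scheme" and G :: "('a, 'b) monoid_scheme"
  assumes H: "group H" and G: "group G" "finitely_generated G"
    and inj: "inj_on \<psi> (carrier H)" and \<psi>: "\<psi> \<in> carrier H \<rightarrow> carrier G"
    and S: "finite_generating_set H S"
    and disp: "\<And>s. s \<in> S \<Longrightarrow> \<exists>E. finite E \<and> E \<subseteq> carrier G \<and>
      (\<forall>x\<in>carrier H. inv\<^bsub>G\<^esub> (\<psi> x) \<otimes>\<^bsub>G\<^esub> \<psi> (x \<otimes>\<^bsub>H\<^esub> s) \<in> E)"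
  shows "regular_group_map H G \<psi>"
  unfolding regular_group_map_def
proof (intro conjI allI impI)
  interpret H: group H by fact
  interpret G: group G by fact
  show "finitely_generated H" using S unfolding finitely_generated_def by blast
  show "finitely_generated G" by fact
  fix U T assume U: "finite_generating_set H U" and T: "finite_generating_set G T"
  have T': "T \<subseteq> carrier G" "generate G T = carrier G" using T unfolding finite_generating_set_def by auto
  have U': "finite U" "U \<subseteq> carrier H" using U unfolding finite_generating_set_def by auto
  let ?R = "parcs (Cayley_graph G T)"
  have step: "\<exists>n. \<forall>x\<in>carrier H. \<exists>k\<le>n. (\<psi> x, \<psi> (x \<otimes>\<^bsub>H\<^esub> u)) \<in> ?R ^^ k" if u: "u \<in> carrier H" for u
  proof -
    have SH: "S \<subseteq> carrier H" and uS: "u \<in> generate H S"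
      using S u unfolding finite_generating_set_def by auto
    have "\<exists>E. finite E \<and> E \<subseteq> carrier G \<and>
        (\<forall>x\<in>carrier H. inv\<^bsub>G\<^esub> (\<psi> x) \<otimes>\<^bsub>G\<^esub> \<psi> (x \<otimes>\<^bsub>H\<^esub> u) \<in> E)"
      by (rule finite_displacement_generate[OF H G(1) \<psi> SH disp uS])
    then obtain E where E: "finite E" "E \<subseteq> carrier G"
      "\<And>x. x \<in> carrier H \<Longrightarrow> inv\<^bsub>G\<^esub> (\<psi> x) \<otimes>\<^bsub>G\<^esub> \<psi> (x \<otimes>\<^bsub>H\<^esub> u) \<in> E"
      by blast
    have "\<forall>e\<in>E. \<exists>n. \<forall>x\<in>carrier G. \<exists>k\<le>n. (x, x \<otimes>\<^bsub>G\<^esub> e) \<in> ?R ^^ k"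
      using G.Cayley_path_generate[OF T'(1)] T'(2) E(2) by blast
    from bchoice[OF this] obtain n where
      n: "\<And>e x. e \<in> E \<Longrightarrow> x \<in> carrier G \<Longrightarrow> \<exists>k\<le>n e. (x, x \<otimes>\<^bsub>G\<^esub> e) \<in> ?R ^^ k" by blast
    have "\<exists>k\<le>sum n E. (\<psi> x, \<psi> (x \<otimes>\<^bsub>H\<^esub> u)) \<in> ?R ^^ k" if x: "x \<in> carrier H" for x
    proof -
      let ?e = "inv\<^bsub>G\<^esub> (\<psi> x) \<otimes>\<^bsub>G\<^esub> \<psi> (x \<otimes>\<^bsub>H\<^esub> u)"
      have c: "\<psi> x \<in> carrier G" "\<psi> (x \<otimes>\<^bsub>H\<^esub> u) \<in> carrier G" using \<psi> x u by auto
      obtain k where k: "k \<le> n ?e" "(\<psi> x, \<psi> x \<otimes>\<^bsub>G\<^esub> ?e) \<in> ?R ^^ k"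
        using n[OF E(3)[OF x] c(1)] by blast
      have "\<psi> x \<otimes>\<^bsub>G\<^esub> ?e = \<psi> (x \<otimes>\<^bsub>H\<^esub> u)" using c by (simp add: G.m_assoc[symmetric])
      moreover have "n ?e \<le> sum n E" using E(1) E(3)[OF x] by (intro member_le_sum) auto
      ultimately show ?thesis using k by (intro exI[of _ k]) auto
    qed
    then show ?thesis by blast
  qed
  \<comment> \<open>An edge of the Cayley graph may multiply by a generator or by an inverse of one.\<close>
  define V where "V = U \<union> m_inv H ` U"
  have V: "finite V" "V \<subseteq> carrier H" using U' unfolding V_def by auto
  have "\<forall>u\<in>V. \<exists>n. \<forall>x\<in>carrier H. \<exists>k\<le>n. (\<psi> x, \<psi> (x \<otimes>\<^bsub>H\<^esub> u)) \<in> ?R ^^ k"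
    using step V by blast
  from bchoice[OF this] obtain n where
    n: "\<And>u x. u \<in> V \<Longrightarrow> x \<in> carrier H \<Longrightarrow> \<exists>k\<le>n u. (\<psi> x, \<psi> (x \<otimes>\<^bsub>H\<^esub> u)) \<in> ?R ^^ k" by blast
  have edges: "\<exists>k\<le>sum n V. (\<psi> x, \<psi> y) \<in> ?R ^^ k" if "(x, y) \<in> parcs (Cayley_graph H U)" for x y
  proof -
    from that obtain u where u: "u \<in> U" "x \<in> carrier H" "y \<in> carrier H"
      "y = x \<otimes>\<^bsub>H\<^esub> u \<or> x = y \<otimes>\<^bsub>H\<^esub> u" unfolding Cayley_graph_def by auto
    then have "y = x \<otimes>\<^bsub>H\<^esub> u \<or> y = x \<otimes>\<^bsub>H\<^esub> inv\<^bsub>H\<^esub> u" using U' by (auto simp: H.m_assoc)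
    then obtain v where v: "v \<in> V" "y = x \<otimes>\<^bsub>H\<^esub> v" using u(1) unfolding V_def by blast
    have "n v \<le> sum n V" using V v by (intro member_le_sum) auto
    then show ?thesis using n[OF v(1) u(2)] v(2) by (meson le_trans)
  qed
  show "regular_graph_map (Cayley_graph H U) (Cayley_graph G T) \<psi>"
    unfolding regular_graph_map_def
  proof (intro conjI)
    show "bounded_degree_graph (Cayley_graph H U)" "bounded_degree_graph (Cayley_graph G T)"
      using U T H G unfolding finite_generating_set_def by (auto intro!: bounded_degree_Cayley_graph)
    show verts: "\<psi> \<in> pverts (Cayley_graph H U) \<rightarrow> pverts (Cayley_graph G T)"
      using \<psi> by (simp add: Cayley_graph_def)
    show "\<exists>K::real. K > 0 \<and> (\<forall>x\<in>pverts (Cayley_graph H U). \<forall>y\<in>pverts (Cayley_graph H U).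
        graph_dist (Cayley_graph G T) (\<psi> x) (\<psi> y) \<le> ereal K * graph_dist (Cayley_graph H U) x y)"
    proof (intro exI[of _ "real (Suc (sum n V))"] conjI ballI)
      fix x y assume "x \<in> pverts (Cayley_graph H U)"
      then show "graph_dist (Cayley_graph G T) (\<psi> x) (\<psi> y)
          \<le> ereal (real (Suc (sum n V))) * graph_dist (Cayley_graph H U) x y"
        using verts edges
        by (intro graph_map_lipschitz H.pair_wf_digraph_Cayley_graph G.pair_wf_digraph_Cayley_graph) auto
    qed (simp only: of_nat_0_less_iff zero_less_Suc)
    show "\<exists>C::real. C \<ge> 1 \<and> (\<forall>b\<in>pverts (Cayley_graph G T).
        finite {a \<in> pverts (Cayley_graph H U). \<psi> a = b} \<and>
        real (card {a \<in> pverts (Cayley_graph H U). \<psi> a = b}) \<le> C)"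
    proof (intro exI[of _ 1] conjI ballI)
      fix b
      define F where "F = {a \<in> pverts (Cayley_graph H U). \<psi> a = b}"
      have "F \<subseteq> {a}" if "a \<in> F" for a
        using inj that by (auto simp: F_def Cayley_graph_def inj_on_def)
      then have "F = {} \<or> (\<exists>a. F = {a})" by blast
      then have "finite F" "real (card F) \<le> 1" by auto
      then show "finite {a \<in> pverts (Cayley_graph H U). \<psi> a = b}"
        "real (card {a \<in> pverts (Cayley_graph H U). \<psi> a = b}) \<le> 1"
        unfolding F_def .
    qed simp
  qed
qed

section \<open>The lamplighter group and its orbit maps\<close>

definition lamp_switch :: "(int \<Rightarrow> int) \<times> int" where
  "lamp_switch = (\<lambda>j. if j = 0 then 1 else 0, 0)"

definition lamp_step :: "(int \<Rightarrow> int) \<times> int" where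
  "lamp_step = (\<lambda>_. 0, 1)"

text \<open>
  Conjugating the switch by a walk to position \<open>j\<close> toggles the lamp at \<open>j\<close>; lamps are lit one by one,
  by induction on the support.
\<close>

lemma lamplighter_generating_set: "finite_generating_set lamplighter_group {lamp_switch, lamp_step}"
proof -
  interpret L: group lamplighter_group by (rule group_lamplighter_group)
  let ?S = "{lamp_switch, lamp_step}"
  let ?N = "generate lamplighter_group ?S"
  have S: "?S \<subseteq> carrier lamplighter_group"
    unfolding lamp_switch_def lamp_step_def by (auto simp: carrier_lamplighter_group)
  have pos: "(\<lambda>_. 0, int n) \<in> ?N" for n
  proof (induct n)
    case 0
    then show ?case using generate.one[of lamplighter_group ?S] by (simp add: one_lamplighter_group)
  next
    case (Suc n)
    have "lamp_step \<in> ?N" by (rule generate.incl) simp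
    from generate.eng[OF this Suc] show ?case by (simp add: lamp_step_def mult_lamplighter_group)
  qed
  have neg: "(\<lambda>_. 0, - int n) \<in> ?N" for n
  proof (induct n)
    case 0
    then show ?case using generate.one[of lamplighter_group ?S] by (simp add: one_lamplighter_group)
  next
    case (Suc n)
    have "inv\<^bsub>lamplighter_group\<^esub> lamp_step = (\<lambda>_. 0, - 1)"
      by (rule L.inv_equality)
        (auto simp: lamp_step_def mult_lamplighter_group one_lamplighter_group carrier_lamplighter_group)
    moreover have "inv\<^bsub>lamplighter_group\<^esub> lamp_step \<in> ?N" by (rule generate.inv) simp
    ultimately have "(\<lambda>_. 0, - 1) \<in> ?N" by simp
    from generate.eng[OF this Suc] show ?case by (simp add: mult_lamplighter_group)
  qed
  have walk: "(\<lambda>_. 0, m) \<in> ?N" for m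
    using pos[of "nat m"] neg[of "nat (- m)"] by (cases "0 \<le> m") auto
  have lamp: "(\<lambda>i. if i = j then 1 else 0, 0) \<in> ?N" for j
  proof -
    have "lamp_switch \<in> ?N" by (rule generate.incl) simp
    from generate.eng[OF generate.eng[OF walk[of j] this] walk[of "- j"]]
    have "(\<lambda>i. (if i - j = 0 then 1 else 0) mod 2, 0) \<in> ?N"
      by (simp add: lamp_switch_def mult_lamplighter_group)
    moreover have "(\<lambda>i. (if i - j = 0 then 1 else 0) mod 2) = (\<lambda>i. if i = j then 1 else (0::int))"
      by auto
    ultimately show ?thesis by simp
  qed
  have "(f, m) \<in> ?N" if "finite A" "{i. f i \<noteq> 0} = A" "\<And>i. f i \<in> {0..<2}" for f m A
    using that
  proof (induct A arbitrary: f)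
    case empty
    then have "f = (\<lambda>_. 0)" by auto
    then show ?case using walk by simp
  next
    case (insert j A)
    have "{i. (f(j := 0)) i \<noteq> 0} = A" using insert(2,4) by auto
    moreover have "(f(j := 0)) i \<in> {0..<2}" for i using insert(5)[of i] by simp
    ultimately have IH: "(f(j := 0), m) \<in> ?N" by (rule insert(3))
    have "f j \<noteq> 0" using insert(4) by blast
    then have "f j = 1" using insert(5)[of j] by auto
    moreover have "f i mod 2 = f i" for i using insert(5)[of i] by (simp add: mod_pos_pos_trivial)
    ultimately have "f = (\<lambda>i. ((if i = j then 1 else 0) + (f(j := 0)) (i - 0)) mod 2)" by auto
    with generate.eng[OF lamp[of j] IH] show ?case by (simp only: mult_lamplighter_group add_0)
  qed
  then have "carrier lamplighter_group \<subseteq> ?N" by (auto simp: carrier_lamplighter_group)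
  moreover have "?N \<subseteq> carrier lamplighter_group" using L.generate_incl[OF S] .
  ultimately show ?thesis using S unfolding finite_generating_set_def by auto
qed

text \<open>
  An equality of products over subsets, read as a relation whose exponents are differences of two
  indicator functions.
\<close>

lemma (in comm_group) coef_box_cancel:
  fixes I :: "'i set"
  assumes x: "x \<in> I \<rightarrow> carrier G" and "finite I" "A \<subseteq> I" "B \<subseteq> I"
    and v: "v \<in> carrier G" and eq: "v \<otimes> finprod G x A = finprod G x B"
  shows "v \<in> coef_box G x I 1"
proof -
  define \<chi> where "\<chi> S i = (if i \<in> S then 1 else (0::int))" for S and i :: 'i
  have ind: "finprod G x S = finprod G (\<lambda>i. x i [^] \<chi> S i) I" if "S \<subseteq> I" for S
    using that assms(2) x
    by (intro finprod_mono_neutral_cong_left) (auto simp: \<chi>_def Pi_iff subset_iff)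
  have "finprod G (\<lambda>i. x i [^] (\<chi> B i - \<chi> A i)) I \<otimes> finprod G x A
      = finprod G (\<lambda>i. x i [^] (\<chi> B i - \<chi> A i) \<otimes> x i [^] \<chi> A i) I"
    unfolding ind[OF assms(3)] using x by (subst finprod_multf) auto
  also have "\<dots> = finprod G (\<lambda>i. x i [^] \<chi> B i) I"
    using x by (intro finprod_cong') (auto simp: Pi_iff int_pow_mult[symmetric])
  also have "\<dots> = v \<otimes> finprod G x A" unfolding eq ind[OF assms(4)] ..
  finally have "finprod G (\<lambda>i. x i [^] (\<chi> B i - \<chi> A i)) I = v"
    using x v assms(3) by (subst (asm) right_cancel) (auto intro!: finprod_closed simp: Pi_iff)
  moreover have "real_of_int \<bar>\<chi> B i - \<chi> A i\<bar> \<le> 1" for i by (simp add: \<chi>_def)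
  ultimately show ?thesis unfolding coef_box_def by (auto intro!: exI[of _ "\<lambda>i. \<chi> B i - \<chi> A i"])
qed

lemma (in comm_group) coef_box_image:
  assumes "h \<in> hom G G" "inj_on e I" "x \<in> e ` I \<rightarrow> carrier G" "v \<in> coef_box G x (e ` I) c"
  shows "h v \<in> coef_box G (\<lambda>i. h (x (e i))) I c"
proof -
  obtain z where z: "v = finprod G (\<lambda>i. x i [^] (z i :: int)) (e ` I)"
    "\<forall>i\<in>e ` I. real_of_int \<bar>z i\<bar> \<le> c"
    using assms(4) unfolding coef_box_def by blast
  have "v = finprod G (\<lambda>i. x (e i) [^] z (e i)) I"
    unfolding z(1) using assms(2,3) by (subst finprod_reindex) (auto simp: Pi_iff)
  then have "h v = finprod G (\<lambda>i. h (x (e i)) [^] z (e i)) I"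
    using assms(1,3) coef_box_hom_finprod[of h "\<lambda>i. x (e i)" I "\<lambda>i. z (e i)"] by auto
  then show ?thesis using z(2) unfolding coef_box_def by (auto intro!: exI[of _ "\<lambda>i. z (e i)"])
qed

context metabelian_extension begin

lemma act_int_pow_add:
  "t \<in> carrier G \<Longrightarrow> a \<in> M \<Longrightarrow> act (t [^] (m + n :: int)) a = act (t [^] m) (act (t [^] n) a)"
  by (simp add: act_mult int_pow_mult)

text \<open>
  Cancel the common part of \<open>A\<close> and \<open>B\<close>, solve for the factor with the largest index \<open>hi\<close>, and translate
  all indices by \<open>- lo\<close> to make them natural numbers. The factor with index \<open>hi\<close> occurs on one side only,
  hence with exponent 1, and the relation is monic.
\<close>

lemma monic_relation_if_products_equal:
  assumes t: "t \<in> carrier G" and a: "a \<in> M" and fin: "finite A" "finite B" and "A \<noteq> B"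
    and eq: "finprod K (\<lambda>i::int. act (t [^] i) a) A = finprod K (\<lambda>i. act (t [^] i) a) B"
  shows "monic_relation t a"
proof -
  define x where "x = (\<lambda>i::int. act (t [^] i) a)"
  have x: "x i \<in> carrier K" for i using t a by (simp add: x_def)
  have main: "monic_relation t a"
    if fin: "finite A" "finite B" and hi: "hi \<in> A" "hi \<notin> B"
      and top: "\<And>j. j \<in> (A - B) \<union> (B - A) \<Longrightarrow> j \<le> hi"
      and eq: "finprod K x A = finprod K x B" for A B hi
  proof -
    define A' B' where "A' = A - B - {hi}" and "B' = B - A"
    have fin': "finite A'" "finite B'" using fin by (auto simp: A'_def B'_def)
    have fc: "finprod K x S \<in> carrier K" for S using x by (intro abelian.finprod_closed) auto
    have "finprod K x A = finprod K x (insert hi A') \<otimes>\<^bsub>K\<^esub> finprod K x (A \<inter> B)"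
      using hi fin x by (subst abelian.finprod_Un_disjoint[symmetric])
        (auto simp: A'_def intro!: arg_cong[where f = "finprod K x"])
    also have "finprod K x (insert hi A') = x hi \<otimes>\<^bsub>K\<^esub> finprod K x A'"
      using x fin' by (intro abelian.finprod_insert) (auto simp: A'_def)
    finally have 1: "finprod K x A = x hi \<otimes>\<^bsub>K\<^esub> finprod K x A' \<otimes>\<^bsub>K\<^esub> finprod K x (A \<inter> B)" .
    have 2: "finprod K x B = finprod K x B' \<otimes>\<^bsub>K\<^esub> finprod K x (A \<inter> B)"
      using fin x by (subst abelian.finprod_Un_disjoint[symmetric])
        (auto simp: B'_def intro!: arg_cong[where f = "finprod K x"])
    have cancel: "x hi \<otimes>\<^bsub>K\<^esub> finprod K x A' = finprod K x B'"
      using eq unfolding 1 2 by (subst (asm) abelian.right_cancel) (use x fc in auto)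
    define lo where "lo = Min (insert hi (A' \<union> B'))"
    have lo: "lo \<le> hi" "\<And>j. j \<in> A' \<union> B' \<Longrightarrow> lo \<le> j" using fin' by (auto simp: lo_def)
    have sub: "j \<in> {lo..<hi}" if j: "j \<in> A' \<union> B'" for j
    proof -
      have "j \<noteq> hi" "j \<le> hi" using top j hi by (auto simp: A'_def B'_def)
      with lo(2)[OF j] show ?thesis by simp
    qed
    define e where "e = (\<lambda>i::nat. lo + int i)"
    define d where "d = nat (hi - lo)"
    have img: "e ` {..<d} = {lo..<hi}"
    proof (intro equalityI subsetI)
      fix j assume "j \<in> {lo..<hi}"
      then show "j \<in> e ` {..<d}"
        by (intro image_eqI[of _ _ "nat (j - lo)"]) (auto simp: e_def d_def)
    qed (auto simp: e_def d_def)
    have "x hi \<in> coef_box K x (e ` {..<d}) 1"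
      unfolding img using sub x cancel by (intro abelian.coef_box_cancel[of x _ A' B']) auto
    then have "act (t [^] (- lo)) (x hi) \<in> coef_box K (\<lambda>i. act (t [^] (- lo)) (x (e i))) {..<d} 1"
      using t x abelian.coef_box_image[of "act (t [^] (- lo))" e "{..<d}" x "x hi" 1]
      by (simp add: act_hom e_def inj_on_def)
    moreover have "act (t [^] (- lo)) (x (e i)) = act (t [^] i) a" for i
      unfolding x_def act_int_pow_add[OF t a, symmetric] by (simp add: e_def int_pow_int)
    moreover have "hi = e d" using lo by (simp add: e_def d_def)
    ultimately show ?thesis unfolding monic_relation_def by (intro exI[of _ d]) simp
  qed
  define S where "S = (A - B) \<union> (B - A)"
  have S: "finite S" "S \<noteq> {}" using fin \<open>A \<noteq> B\<close> by (auto simp: S_def)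
  have "Max S \<in> S" and top: "\<And>j. j \<in> S \<Longrightarrow> j \<le> Max S" using S by auto
  then consider "Max S \<in> A" "Max S \<notin> B" | "Max S \<in> B" "Max S \<notin> A" unfolding S_def by auto
  then show ?thesis
  proof cases
    case 1
    then show ?thesis
      by (rule main[OF fin]) (use top eq in \<open>auto simp: S_def x_def\<close>)
  next
    case 2
    then show ?thesis
      by (rule main[OF fin(2,1)]) (use top eq in \<open>auto simp: S_def x_def\<close>)
  qed
qed

text \<open>
  The natural evaluation of a lamp configuration: a lamp at \<open>i\<close> becomes \<open>t^i a t^-i\<close>. It is not a
  homomorphism unless \<open>a\<close> has order dividing 2.
\<close>

definition lamplighter_map :: "'a \<Rightarrow> 'a \<Rightarrow> (int \<Rightarrow> int) \<times> int \<Rightarrow> 'a" where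
  "lamplighter_map t a = (\<lambda>(f, m). finprod K (\<lambda>i. act (t [^] i) a) {i. f i \<noteq> 0} \<otimes> t [^] m)"

lemma lamp_product_closed:
  assumes "t \<in> carrier G" "a \<in> M"
  shows "finprod K (\<lambda>i::int. act (t [^] i) a) A \<in> M"
  using abelian.finprod_closed[of "\<lambda>i::int. act (t [^] i) a" A] assms by simp

lemma lamplighter_map_closed:
  "t \<in> carrier G \<Longrightarrow> a \<in> M \<Longrightarrow> lamplighter_map t a \<in> carrier lamplighter_group \<rightarrow> carrier G"
  unfolding lamplighter_map_def using lamp_product_closed in_carrier by auto

lemma lamplighter_map_step:
  assumes t: "t \<in> carrier G" and a: "a \<in> M" and x: "x \<in> carrier lamplighter_group"
  shows "lamplighter_map t a (x \<otimes>\<^bsub>lamplighter_group\<^esub> lamp_step) = lamplighter_map t a x \<otimes> t"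
proof -
  obtain f m where fm: "x = (f, m)" "\<And>i. f i \<in> {0..<2}"
    using x by (auto simp: carrier_lamplighter_group)
  have "f i mod 2 = f i" for i using fm(2)[of i] by (simp add: mod_pos_pos_trivial)
  then have "x \<otimes>\<^bsub>lamplighter_group\<^esub> lamp_step = (f, m + 1)"
    by (simp add: fm(1) lamp_step_def mult_lamplighter_group)
  then show ?thesis
    using t a lamp_product_closed in_carrier
    by (simp add: fm(1) lamplighter_map_def m_assoc int_pow_mult)
qed

text \<open>
  Moving \<open>t^m\<close> across the new factor \<open>t^m a t^-m\<close> leaves the factor \<open>a\<close> on the right: switching the lamp at
  the current position is right multiplication by \<open>a\<close>, or by its inverse if the lamp was on.
\<close>

lemma lamplighter_map_insert:
  assumes t: "t \<in> carrier G" and a: "a \<in> M" and "finite A" "m \<notin> A"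
  shows "finprod K (\<lambda>i. act (t [^] i) a) (insert m A) \<otimes> t [^] (m::int)
       = finprod K (\<lambda>i. act (t [^] i) a) A \<otimes> t [^] m \<otimes> a"
proof -
  let ?P = "finprod K (\<lambda>i. act (t [^] i) a) A"
  have P: "?P \<in> M" by (rule lamp_product_closed[OF t a])
  have "finprod K (\<lambda>i. act (t [^] i) a) (insert m A) = act (t [^] m) a \<otimes>\<^bsub>K\<^esub> ?P"
    using assms by (intro abelian.finprod_insert) auto
  also have "\<dots> = ?P \<otimes>\<^bsub>K\<^esub> act (t [^] m) a"
    using P t a by (intro abelian.m_comm) auto
  finally have *: "finprod K (\<lambda>i. act (t [^] i) a) (insert m A) = ?P \<otimes> act (t [^] m) a" by simp
  have "act (t [^] m) a \<otimes> t [^] m = t [^] m \<otimes> a"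
    unfolding act_def using t a in_carrier by (simp add: m_assoc)
  then show ?thesis
    unfolding * using P t a in_carrier by (simp add: m_assoc)
qed

lemma lamplighter_map_switch:
  assumes t: "t \<in> carrier G" and a: "a \<in> M" and x: "x \<in> carrier lamplighter_group"
  shows "inv (lamplighter_map t a x) \<otimes> lamplighter_map t a (x \<otimes>\<^bsub>lamplighter_group\<^esub> lamp_switch) \<in> {a, inv a}"
proof -
  obtain f m where fm: "x = (f, m)" "\<And>i. f i \<in> {0..<2}" "finite {i. f i \<noteq> 0}"
    using x by (auto simp: carrier_lamplighter_group)
  define g where "g j = (f j + (if j - m = 0 then 1 else 0)) mod 2" for j
  have gx: "x \<otimes>\<^bsub>lamplighter_group\<^esub> lamp_switch = (g, m)"
    by (simp add: fm(1) lamp_switch_def mult_lamplighter_group g_def fun_eq_iff)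
  have f01: "f j = 0 \<or> f j = 1" for j using fm(2)[of j] by auto
  have \<psi>: "lamplighter_map t a (f, m) \<in> carrier G" "lamplighter_map t a (g, m) \<in> carrier G"
    using t a lamp_product_closed in_carrier by (auto simp: lamplighter_map_def)
  have aG: "a \<in> carrier G" using a in_carrier by auto
  show ?thesis
  proof (cases "f m = 0")
    case True
    have "{i. g i \<noteq> 0} = insert m {i. f i \<noteq> 0}"
      using True f01 by (auto simp: g_def) (metis mod_0 one_mod_two_eq_one zero_neq_one)+
    then have "lamplighter_map t a (g, m) = lamplighter_map t a (f, m) \<otimes> a"
      using lamplighter_map_insert[OF t a fm(3), of m] True by (simp add: lamplighter_map_def)
    then show ?thesis unfolding gx unfolding fm(1) using \<psi> aG by (simp add: m_assoc[symmetric])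
  next
    case False
    have g: "{i. f i \<noteq> 0} = insert m {i. g i \<noteq> 0}" "g m = 0"
      using False f01[of m] f01 by (auto simp: g_def) (metis mod_0 one_mod_two_eq_one zero_neq_one)+
    then have "finite {i. g i \<noteq> 0}" using fm(3) by simp
    then have eq: "lamplighter_map t a (f, m) = lamplighter_map t a (g, m) \<otimes> a"
      using lamplighter_map_insert[OF t a, of "{i. g i \<noteq> 0}" m] g by (simp add: lamplighter_map_def)
    have "inv (lamplighter_map t a (f, m)) \<otimes> lamplighter_map t a (g, m) = inv a"
      unfolding eq using \<psi>(2) aG by (simp add: inv_mult_group m_assoc)
    then show ?thesis unfolding gx unfolding fm(1) by simp
  qed
qed

text \<open>
  The Lipschitz property holds for every \<open>t\<close> and \<open>a\<close>; only injectivity is a condition on them.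
\<close>

lemma lamplighter_map_regular:
  assumes t: "t \<in> carrier G" and a: "a \<in> M" and "finitely_generated G"
    and "inj_on (lamplighter_map t a) (carrier lamplighter_group)"
  shows "regular_group_map lamplighter_group G (lamplighter_map t a)"
proof (rule inj_regular_group_map)
  interpret L: group lamplighter_group by (rule group_lamplighter_group)
  have aG: "a \<in> carrier G" using a in_carrier by auto
  fix s assume s: "s \<in> {lamp_switch, lamp_step}"
  have sL: "s \<in> carrier lamplighter_group"
    using s lamplighter_generating_set unfolding finite_generating_set_def by auto
  have "inv (lamplighter_map t a x) \<otimes> lamplighter_map t a (x \<otimes>\<^bsub>lamplighter_group\<^esub> s) \<in> {a, inv a, t}"
    if x: "x \<in> carrier lamplighter_group" for x
  proof (cases "s = lamp_switch")
    case True
    then show ?thesis using lamplighter_map_switch[OF t a x] by auto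
  next
    case False
    then have "s = lamp_step" using s by auto
    moreover have "lamplighter_map t a x \<in> carrier G" using lamplighter_map_closed[OF t a] x by auto
    ultimately show ?thesis using t by (simp add: lamplighter_map_step[OF t a x] m_assoc[symmetric])
  qed
  then show "\<exists>E. finite E \<and> E \<subseteq> carrier G \<and> (\<forall>x\<in>carrier lamplighter_group.
      inv (lamplighter_map t a x) \<otimes> lamplighter_map t a (x \<otimes>\<^bsub>lamplighter_group\<^esub> s) \<in> E)"
    using aG t by (intro exI[of _ "{a, inv a, t}"]) auto
qed (use assms lamplighter_map_closed lamplighter_generating_set group_lamplighter_group is_group in auto)

lemma monic_relation_of_commuting_power:
  assumes t: "t \<in> carrier G" and a: "a \<in> M" and "0 < k" and fixed: "act (t [^] (k::nat)) a = a"
  shows "monic_relation t a"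
proof -
  have "act (t [^] (0::nat)) a \<in> coef_box K (\<lambda>i. act (t [^] i) a) {..<k} 1"
    using assms by (intro abelian.coef_box_generator) auto
  then show ?thesis using fixed a unfolding monic_relation_def by (intro exI[of _ k]) simp
qed

text \<open>
  If two configurations with different end positions are identified, a nonzero power of \<open>t\<close> lies in
  \<open>M\<close> and thus fixes \<open>a\<close>, so the orbit of \<open>a\<close> is periodic. If the end positions agree, the
  products over two different sets of lamps coincide.
\<close>

lemma monic_relation_if_not_inj:
  assumes t: "t \<in> carrier G" and a: "a \<in> M"
    and "\<not> inj_on (lamplighter_map t a) (carrier lamplighter_group)"
  shows "monic_relation t a"
proof -
  obtain f m g n where fm: "(f, m) \<in> carrier lamplighter_group" and gn: "(g, n) \<in> carrier lamplighter_group"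
    and ne: "(f, m) \<noteq> (g, n)" and eq: "lamplighter_map t a (f, m) = lamplighter_map t a (g, n)"
    using assms(3) unfolding inj_on_def by auto
  let ?P = "\<lambda>f. finprod K (\<lambda>i. act (t [^] i) a) {i::int. f i \<noteq> (0::int)}"
  have P: "?P f \<in> M" "?P f \<in> carrier G" for f using lamp_product_closed[OF t a] in_carrier by auto
  have eq': "?P f \<otimes> t [^] m = ?P g \<otimes> t [^] n" using eq by (simp add: lamplighter_map_def)
  \<comment> \<open>The two sides of the equation act on \<open>a\<close> through \<open>t ^ m\<close> and \<open>t ^ n\<close> only, as elements of \<open>M\<close> act trivially.\<close>
  have "act (t [^] m) a = act (t [^] n) a"
  proof -
    have "act (?P f \<otimes> t [^] m) a = act (t [^] m) a" "act (?P g \<otimes> t [^] n) a = act (t [^] n) a"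
      using P t a by (auto simp: act_mult act_trivial)
    then show ?thesis using eq' by simp
  qed
  then have shift: "act (t [^] (m + k)) a = act (t [^] (n + k)) a" for k
    using t a by (simp add: add.commute[of _ k] act_int_pow_add)
  consider "m < n" | "n < m" | "m = n" by linarith
  then show ?thesis
  proof cases
    case 1
    then show ?thesis using shift[of "- m"] t a
      by (intro monic_relation_of_commuting_power[of t a "nat (n - m)"])
        (auto simp flip: int_pow_int)
  next
    case 2
    then show ?thesis using shift[of "- n"] t a
      by (intro monic_relation_of_commuting_power[of t a "nat (m - n)"])
        (auto simp flip: int_pow_int)
  next
    case 3
    have same: "?P f = ?P g" using eq' P t unfolding 3 by (subst (asm) right_cancel) auto
    have differ: "{i. f i \<noteq> 0} \<noteq> {i. g i \<noteq> 0}"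
    proof
      assume supp: "{i. f i \<noteq> 0} = {i. g i \<noteq> 0}"
      have "f i = g i" for i
      proof -
        have "f i \<in> {0..<2}" "g i \<in> {0..<2}" using fm gn by (auto simp: carrier_lamplighter_group)
        moreover have "f i \<noteq> 0 \<longleftrightarrow> g i \<noteq> 0" using supp by blast
        ultimately show ?thesis by auto
      qed
      with ne 3 show False by auto
    qed
    have "finite {i. f i \<noteq> 0}" "finite {i. g i \<noteq> 0}"
      using fm gn by (auto simp: carrier_lamplighter_group)
    then show ?thesis by (rule monic_relation_if_products_equal[OF t a _ _ differ same])
  qed
qed

end

theorem theorem1p3:
  fixes G :: "('a, 'b) monoid_scheme"
  assumes "group G"
    and "finitely_generated G"
    and "metabelian G"
    and "exponential_growth G"
  shows "\<exists>\<phi>. inj_on \<phi> (carrier lamplighter_group) \<and> regular_group_map lamplighter_group G \<phi>"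
proof (rule ccontr)
  assume none: "\<not> ?thesis"
  interpret group G by fact
  define M where "M = derived G (carrier G)"
  have "normal M G" unfolding M_def by (rule derived_is_normal[OF normal_self])
  moreover have "comm_group (G\<lparr>carrier := M\<rparr>)" using assms(3) unfolding metabelian_def M_def .
  moreover have "x \<otimes>\<^bsub>G\<^esub> y \<otimes>\<^bsub>G\<^esub> inv\<^bsub>G\<^esub> x \<otimes>\<^bsub>G\<^esub> inv\<^bsub>G\<^esub> y \<in> M" if "x \<in> carrier G" "y \<in> carrier G" for x y
    unfolding M_def derived_def using that by (intro generate.incl) auto
  ultimately interpret metabelian_extension M G
    by (simp add: metabelian_extension_def metabelian_extension_axioms_def)
  have rel: "monic_relation t a" if "t \<in> carrier G" "a \<in> M" for t a
    using none lamplighter_map_regular[OF that assms(2)] monic_relation_if_not_inj[OF that] by blast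
  obtain S and b :: real where S: "finite S" "S \<subseteq> carrier G" and b: "1 < b"
    and ball: "\<And>n. b ^ n \<le> real (card (Cayley_ball G S n))"
    using assms(4) unfolding exponential_growth_def finite_generating_set_def by blast
  define L where "L = insert \<one>\<^bsub>G\<^esub> (S \<union> m_inv G ` S)"
  have L: "finite L" "L \<subseteq> carrier G" using S unfolding L_def by auto
  show False
  proof (rule exponential_growth_excludes_monic_relations[OF rel L b])
    fix n
    have "finite {w \<in> lists L. length w = n}"
      using finite_lists_length_eq[OF L(1), of n] by (simp add: lists_eq_set)
    then have "card (Cayley_ball G S n) \<le> card (eval_word ` {w \<in> lists L. length w = n})"
      using Cayley_ball_words[OF S(2), of n] unfolding L_def by (intro card_mono) auto
    then show "b ^ n \<le> real (card (eval_word ` {w \<in> lists L. length w = n}))"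
      using ball[of n] by linarith
  qed
qed

end
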